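(* Let $\mathbb{k}$ be a field of characteristic $0$, let $n\ge 0$ and let $\alpha$ be a composition of $n$. Then the $\mathbb{k}$-linear operator $\mathbb{k}\Sigma_n\to\mathbb{k}\Sigma_n$, $\mathbf{F}\mapsto\mathbf{F}\,\widetilde{w}_0\,\widetilde{B}_\alpha$ is diagonalizable, and its eigenvalues are the signed knapsack numbers $\widetilde{n}_\alpha(F)$ of the faces $F\in\Sigma_n$; the algebraic multiplicity of each eigenvalue $\lambda$ is the number of faces $F\in\Sigma_n$ with $\widetilde{n}_\alpha(F)=\lambda$.
   Context: Notation: $[n]=\{1,\ldots,n\}$; $S_n$ is the symmetric group with $(\sigma\tau)(i)=\sigma(\tau(i))$ and $\mathbb{k}S_n$ its group algebra; $w_0(i)=n+1-i$. For a composition $\beta=(\beta_1,\ldots,\beta_k)$ of $n$ (positive integers with sum $n$), let $D(\beta)=\{\beta_1,\beta_1+\beta_2,\ldots,\beta_1+\cdots+\beta_{k-1}\}$ and $B_\beta=\sum_{w\in S_n:\operatorname{Des}w\subseteq D(\beta)}w$, where $\operatorname{Des}w=\{i\in[n-1]:w(i)>w(i+1)\}$. The $B_\beta$ are linearly independent; their span is the descent algebra $\mathcal{D}(S_n)$, and $w_0\in\mathcal{D}(S_n)$. A face (set composition) of $[n]$ is a tuple $F=(F_1,\ldots,F_k)$ of nonempty pairwise disjoint sets with union $[n]$; $\ell(F)=k$, $\operatorname{type}F=(|F_1|,\ldots,|F_k|)$; $\Sigma_n$ is the set of faces. The product of faces $F=(F_1,\ldots,F_k)$ and $G=(G_1,\ldots,G_m)$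 is the tuple of the intersections $F_i\cap G_j$ listed in lexicographic order of $(i,j)$, with empty sets removed; this makes $\Sigma_n$ a monoid with identity $([n])$, and $\mathbb{k}\Sigma_n$ is its monoid algebra. $\widetilde{B}_\beta=\sum_{F\in\Sigma_n:\operatorname{type}F=\beta}F$. Let $\rho:\mathcal{D}(S_n)\to\mathbb{k}\Sigma_n$ be the $\mathbb{k}$-linear map with $\rho(B_\beta)=\widetilde{B}_\beta$ for all compositions $\beta$, and $\widetilde{w}_0:=\rho(w_0)$. $F\preceq G$ means each block of $F$ lies in some block of $G$; $n_\alpha(F)=\#\{G\in\Sigma_n:F\preceq G,\ \operatorname{type}G=\alpha\}$; $\widetilde{n}_\alpha(F)=(-1)^{n-\ell(F)}n_\alpha(F)$. *)

theory Defs
  imports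
    "Jordan_Normal_Form.Char_Poly"
    "HOL-Library.Poly_Mapping"
    "HOL-Combinatorics.Permutations"
begin

section \<open>Formal linear combinations\<close>

definition lc_scale :: "'k::field \<Rightarrow> ('a \<Rightarrow>\<^sub>0 'k) \<Rightarrow> ('a \<Rightarrow>\<^sub>0 'k)" where
  "lc_scale c f = Poly_Mapping.map ((*) c) f"

lemma lookup_lc_scale [simp]:
  "Poly_Mapping.lookup (lc_scale c f) x = c * Poly_Mapping.lookup f x"
  by (simp add: lc_scale_def Poly_Mapping.map.rep_eq when_def)

global_interpretation lc: vector_space "lc_scale :: 'k::field \<Rightarrow> ('a \<Rightarrow>\<^sub>0 'k) \<Rightarrow> _"
  by unfold_locales
    (auto intro!: poly_mapping_eqI simp: lookup_add algebra_simps)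

abbreviation lc_of :: "'a \<Rightarrow> ('a \<Rightarrow>\<^sub>0 'k::field)" where
  "lc_of x \<equiv> Poly_Mapping.single x 1"

section \<open>Operators on a finite-dimensional subspace\<close>

definition eigenvalue_on ::
  "('a \<Rightarrow>\<^sub>0 'k::field) set \<Rightarrow> (('a \<Rightarrow>\<^sub>0 'k) \<Rightarrow> ('a \<Rightarrow>\<^sub>0 'k)) \<Rightarrow> 'k \<Rightarrow> bool" where
  "eigenvalue_on V T c \<longleftrightarrow> (\<exists>v\<in>V. v \<noteq> 0 \<and> T v = lc_scale c v)"

definition diagonalizable_on ::
  "('a \<Rightarrow>\<^sub>0 'k::field) set \<Rightarrow> (('a \<Rightarrow>\<^sub>0 'k) \<Rightarrow> ('a \<Rightarrow>\<^sub>0 'k)) \<Rightarrow> bool" where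
  "diagonalizable_on V T \<longleftrightarrow>
     (\<exists>E. lc.independent E \<and> lc.span E = V \<and> (\<forall>v\<in>E. \<exists>c. T v = lc_scale c v))"

definition ordered_basis_of :: "('a \<Rightarrow>\<^sub>0 'k::field) set \<Rightarrow> ('a \<Rightarrow>\<^sub>0 'k) list \<Rightarrow> bool" where
  "ordered_basis_of V bs \<longleftrightarrow>
     distinct bs \<and> lc.independent (set bs) \<and> lc.span (set bs) = V"

definition matrix_wrt ::
  "('a \<Rightarrow>\<^sub>0 'k::field) list \<Rightarrow> (('a \<Rightarrow>\<^sub>0 'k) \<Rightarrow> ('a \<Rightarrow>\<^sub>0 'k)) \<Rightarrow> 'k mat" where
  "matrix_wrt bs T =
     mat (length bs) (length bs) (\<lambda>(i, j). lc.representation (set bs) (T (bs ! j)) (bs ! i))"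

text \<open>Meaningful for \<open>V\<close> finite-dimensional and \<open>T\<close> a linear endomorphism of \<open>V\<close>; matrices of
  \<open>T\<close> in different bases are similar, so the choice of the basis does not matter.\<close>

definition char_poly_on ::
  "('a \<Rightarrow>\<^sub>0 'k::field) set \<Rightarrow> (('a \<Rightarrow>\<^sub>0 'k) \<Rightarrow> ('a \<Rightarrow>\<^sub>0 'k)) \<Rightarrow> 'k poly" where
  "char_poly_on V T = char_poly (matrix_wrt (SOME bs. ordered_basis_of V bs) T)"

definition alg_multiplicity_on ::
  "('a \<Rightarrow>\<^sub>0 'k::field) set \<Rightarrow> (('a \<Rightarrow>\<^sub>0 'k) \<Rightarrow> ('a \<Rightarrow>\<^sub>0 'k)) \<Rightarrow> 'k \<Rightarrow> nat" where
  "alg_multiplicity_on V T c = Polynomial.order c (char_poly_on V T)"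

section \<open>Compositions and the descent algebra\<close>

definition compositions :: "nat \<Rightarrow> nat list set" where
  "compositions n = {\<beta>. (\<forall>b\<in>set \<beta>. b > 0) \<and> sum_list \<beta> = n}"

definition comp_partial_sums :: "nat list \<Rightarrow> nat set" where
  "comp_partial_sums \<beta> = {sum_list (take i \<beta>) | i. 1 \<le> i \<and> i < length \<beta>}"

definition Des :: "nat \<Rightarrow> (nat \<Rightarrow> nat) \<Rightarrow> nat set" where
  "Des n w = {i\<in>{1..<n}. w i > w (i + 1)}"

definition B_elem :: "nat \<Rightarrow> nat list \<Rightarrow> ((nat \<Rightarrow> nat) \<Rightarrow>\<^sub>0 'k::field)" where
  "B_elem n \<beta> = (\<Sum>w \<in> {w. w permutes {1..n} \<and> Des n w \<subseteq> comp_partial_sums \<beta>}. lc_of w)"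

definition descent_algebra :: "nat \<Rightarrow> ((nat \<Rightarrow> nat) \<Rightarrow>\<^sub>0 'k::field) set" where
  "descent_algebra n = lc.span (B_elem n ` compositions n)"

definition w0_perm :: "nat \<Rightarrow> nat \<Rightarrow> nat" where
  "w0_perm n i = (if i \<in> {1..n} then n + 1 - i else i)"

section \<open>The face algebra\<close>

definition faces :: "nat \<Rightarrow> nat set list set" where
  "faces n = {F. (\<forall>A\<in>set F. A \<noteq> {}) \<and>
     (\<forall>i<length F. \<forall>j<length F. i \<noteq> j \<longrightarrow> F ! i \<inter> F ! j = {}) \<and> \<Union>(set F) = {1..n}}"

definition face_type :: "nat set list \<Rightarrow> nat list" where
  "face_type F = map card F"

definition face_prod :: "nat set list \<Rightarrow> nat set list \<Rightarrow> nat set list" where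
  "face_prod F G = [A \<inter> B. A \<leftarrow> F, B \<leftarrow> G, A \<inter> B \<noteq> {}]"

definition face_algebra :: "nat \<Rightarrow> (nat set list \<Rightarrow>\<^sub>0 'k::field) set" where
  "face_algebra n = {f. Poly_Mapping.keys f \<subseteq> faces n}"

definition face_mult ::
  "(nat set list \<Rightarrow>\<^sub>0 'k::field) \<Rightarrow> (nat set list \<Rightarrow>\<^sub>0 'k) \<Rightarrow> (nat set list \<Rightarrow>\<^sub>0 'k)"
  (infixl \<open>\<star>\<close> 70) where
  "f \<star> g = (\<Sum>F\<in>Poly_Mapping.keys f. \<Sum>G\<in>Poly_Mapping.keys g.
     Poly_Mapping.single (face_prod F G) (Poly_Mapping.lookup f F * Poly_Mapping.lookup g G))"

lemma face_mult_superset: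
  assumes "finite A" "Poly_Mapping.keys f \<subseteq> A"
  shows "f \<star> g = (\<Sum>F\<in>A. \<Sum>G\<in>Poly_Mapping.keys g.
     Poly_Mapping.single (face_prod F G) (Poly_Mapping.lookup f F * Poly_Mapping.lookup g G))"
  unfolding face_mult_def
  by (rule sum.mono_neutral_left) (use assms in \<open>auto simp: in_keys_iff\<close>)

lemma face_mult_add_left: "(f + f') \<star> g = f \<star> g + f' \<star> g"
proof -
  let ?A = "Poly_Mapping.keys f \<union> Poly_Mapping.keys f'"
  have "finite ?A" by simp
  moreover have "Poly_Mapping.keys (f + f') \<subseteq> ?A" by (rule Poly_Mapping.keys_add)
  ultimately show ?thesis
    by (simp add: face_mult_superset[of ?A] lookup_add distrib_right single_add sum.distrib)
qed

lemma face_mult_scale_left: "lc_scale c f \<star> g = lc_scale c (f \<star> g)"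
proof -
  have "Poly_Mapping.keys (lc_scale c f) \<subseteq> Poly_Mapping.keys f"
    by (auto simp: in_keys_iff)
  then show ?thesis
    by (auto simp: face_mult_superset[of "Poly_Mapping.keys f"] lookup_sum lookup_single
        sum_distrib_left when_def mult.assoc intro!: poly_mapping_eqI sum.cong)
qed

lemma faces_iff:
  "F \<in> faces n \<longleftrightarrow> (\<forall>A\<in>set F. A \<noteq> {}) \<and> sorted_wrt disjnt F \<and> \<Union>(set F) = {1..n}"
proof -
  have "(\<forall>i<length F. \<forall>j<length F. i \<noteq> j \<longrightarrow> F ! i \<inter> F ! j = {}) \<longleftrightarrow> sorted_wrt disjnt F"
  proof
    assume *: "sorted_wrt disjnt F"
    show "\<forall>i<length F. \<forall>j<length F. i \<noteq> j \<longrightarrow> F ! i \<inter> F ! j = {}"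
    proof (intro allI impI)
      fix i j assume "i < length F" "j < length F" "i \<noteq> j"
      then consider "i < j" | "j < i" by linarith
      then show "F ! i \<inter> F ! j = {}"
        by cases (use * \<open>i < length F\<close> \<open>j < length F\<close> in
            \<open>auto simp: sorted_wrt_iff_nth_less disjnt_def Int_commute\<close>)
    qed
  qed (auto simp: sorted_wrt_iff_nth_less disjnt_def)
  then show ?thesis by (simp add: faces_def)
qed

lemma face_prod_in_faces:
  assumes F: "F \<in> faces n" and G: "G \<in> faces n"
  shows "face_prod F G \<in> faces n"
proof -
  have row: "sorted_wrt disjnt [A \<inter> B. B \<leftarrow> Gs, A \<inter> B \<noteq> {}]"
    if "sorted_wrt disjnt Gs" for A and Gs :: "nat set list"
    using that by (induction Gs) (auto simp: disjnt_iff)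
  have "sorted_wrt disjnt [A \<inter> B. A \<leftarrow> Fs, B \<leftarrow> G, A \<inter> B \<noteq> {}]"
    if "sorted_wrt disjnt Fs" for Fs
    using that
  proof (induction Fs)
    case (Cons A Fs)
    have "sorted_wrt disjnt [A \<inter> B. B \<leftarrow> G, A \<inter> B \<noteq> {}]"
      using G row unfolding faces_iff by blast
    then show ?case using Cons by (simp add: sorted_wrt_append) (force simp: disjnt_iff)
  qed simp
  then have "sorted_wrt disjnt (face_prod F G)"
    using F unfolding faces_iff face_prod_def by blast
  moreover have set_eq: "set (face_prod F G) = {A \<inter> B | A B. A \<in> set F \<and> B \<in> set G \<and> A \<inter> B \<noteq> {}}"
    unfolding face_prod_def by auto
  moreover have "\<Union>(set (face_prod F G)) = \<Union>(set F) \<inter> \<Union>(set G)"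
    unfolding set_eq by blast
  ultimately show ?thesis
    using F G unfolding faces_iff by auto
qed

lemma face_mult_in_face_algebra:
  assumes "f \<in> face_algebra n" "g \<in> face_algebra n"
  shows "f \<star> g \<in> face_algebra n"
proof -
  have "F \<in> faces n" if "F \<in> Poly_Mapping.keys (f \<star> g)" for F
  proof (rule ccontr)
    assume "F \<notin> faces n"
    then have "Poly_Mapping.lookup (f \<star> g) F = 0"
      using assms unfolding face_algebra_def face_mult_def lookup_sum
      by (intro sum.neutral ballI) (auto simp: lookup_single when_def dest: face_prod_in_faces)
    then show False using that by (simp add: in_keys_iff)
  qed
  then show ?thesis by (auto simp: face_algebra_def)
qed

definition B_tilde :: "nat \<Rightarrow> nat list \<Rightarrow> (nat set list \<Rightarrow>\<^sub>0 'k::field)" where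
  "B_tilde n \<beta> = (\<Sum>F \<in> {F\<in>faces n. face_type F = \<beta>}. lc_of F)"

text \<open>These conditions determine \<open>\<rho>\<close> uniquely on the descent algebra; its values elsewhere are
  irrelevant. Such a \<open>\<rho>\<close> exists because the elements \<open>B_elem n \<beta>\<close> are linearly independent.\<close>

definition is_rho ::
  "nat \<Rightarrow> (((nat \<Rightarrow> nat) \<Rightarrow>\<^sub>0 'k::field) \<Rightarrow> (nat set list \<Rightarrow>\<^sub>0 'k)) \<Rightarrow> bool" where
  "is_rho n \<rho> \<longleftrightarrow>
     (\<forall>x\<in>descent_algebra n. \<forall>y\<in>descent_algebra n. \<rho> (x + y) = \<rho> x + \<rho> y) \<and>
     (\<forall>c. \<forall>x\<in>descent_algebra n. \<rho> (lc_scale c x) = lc_scale c (\<rho> x)) \<and>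
     (\<forall>\<beta>\<in>compositions n. \<rho> (B_elem n \<beta>) = B_tilde n \<beta>)"

section \<open>Knapsack numbers\<close>

definition refines :: "nat set list \<Rightarrow> nat set list \<Rightarrow> bool" where
  "refines F G \<longleftrightarrow> (\<forall>A\<in>set F. \<exists>B\<in>set G. A \<subseteq> B)"

definition knapsack :: "nat \<Rightarrow> nat list \<Rightarrow> nat set list \<Rightarrow> nat" where
  "knapsack n \<alpha> F = card {G\<in>faces n. refines F G \<and> face_type G = \<alpha>}"

text \<open>The subtraction does not truncate, since a face of \<open>{1..n}\<close> has at most \<open>n\<close> blocks.\<close>

definition signed_knapsack :: "nat \<Rightarrow> nat list \<Rightarrow> nat set list \<Rightarrow> int" where
  "signed_knapsack n \<alpha> F = (-1) ^ (n - length F) * int (knapsack n \<alpha> F)"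

end

theory Submission
  imports Defs
begin

text \<open>Right multiplication by \<open>w0_tilde n = \<Sum>\<^sub>G (-1)\<^bsup>n-\<ell>(G)\<^esup> G\<close> is an involution: the elements
  \<open>\<psi>\<^sub>N = \<Sum>\<^sub>G (N choose \<ell>(G)) G\<close> satisfy \<open>\<psi>\<^sub>N \<psi>\<^sub>M = \<psi>\<^bsub>NM\<^esub>\<close> for natural numbers, hence as a polynomial
  identity, and \<open>w0_tilde n\<close> is \<open>\<psi>\<^bsub>-1\<^esub>\<close> up to sign. Let \<open>W\<^sub>m\<close> be spanned by the faces with knapsack
  number at least \<open>m\<close>. Right multiplication by \<open>B_tilde n \<alpha>\<close> is the scalar \<open>m\<close> on \<open>W\<^sub>m / W\<^bsub>m+1\<^esub>\<close>, so
  \<open>T\<^sup>2 - m\<^sup>2\<close> maps \<open>W\<^sub>m\<close> into \<open>W\<^bsub>m+1\<^esub>\<close>, while \<open>T\<close> maps everything into \<open>W\<^sub>1\<close>. Thus \<open>T\<close> is annihilated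
  by a product of distinct linear factors. Since a product \<open>F G\<close> is \<open>F\<close> or has more blocks
  than \<open>F\<close>, \<open>T\<close> is triangular, and the signed knapsack numbers are its diagonal entries.\<close>

section \<open>The monoid of faces\<close>

text \<open>On a single layer of the filtration, right multiplication by \<open>w0_tilde n\<close>
  is only known to be an involution, not a scalar, so m and -m may both occur there; hence the
  square of T. For m > 0, characteristic 0 separates m from -m. At m = 0 they coincide, so the
  single factor T has to suffice; it does, because \<open>B_tilde n \<alpha>\<close> kills the
  bottom layer whatever \<open>w0_tilde n\<close> did before.

  The coefficient N choose l(G) counts the functions {1..n} -> {..<N} whose nonempty fibres, in
  order, form G. The product of two fibre faces is the fibre face of the paired function, which is
  why the elements \<open>\<psi>\<^sub>N\<close> multiply. The signs on the diagonal have the same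
  source: N ^ l(F) functions are constant on the blocks of F, and N = -1 is substituted.

  The closed form of the image of w0 comes from inclusion-exclusion over descent sets: w0 is the
  only permutation that descends everywhere.\<close>

definition block_split :: "nat set \<Rightarrow> nat set list \<Rightarrow> nat set list" where
  "block_split A G = [A \<inter> B. B \<leftarrow> G, A \<inter> B \<noteq> {}]"

lemma block_split_simps [simp]:
  "block_split A [] = []"
  "block_split A (B # G) = (if A \<inter> B = {} then block_split A G else (A \<inter> B) # block_split A G)"
  by (simp_all add: block_split_def)

lemma block_split_append [simp]:
  "block_split A (G @ G') = block_split A G @ block_split A G'"
  by (simp add: block_split_def)

lemma face_prod_simps [simp]:
  "face_prod [] G = []"
  "face_prod (A # F) G = block_split A G @ face_prod F G"
  by (simp_all add: face_prod_def block_split_def)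

lemma face_prod_append [simp]: "face_prod (F @ F') G = face_prod F G @ face_prod F' G"
  by (simp add: face_prod_def)

lemma block_split_block_split: "block_split A (block_split B G) = block_split (A \<inter> B) G"
  by (induction G) (auto simp: Int_assoc)

text \<open>The case that matters is a block B of G disjoint from A: it is dropped on the right, and
  on the left its pieces are cut by the empty set. Associativity of the product is this identity,
  applied to each block of the leftmost factor.\<close>

lemma block_split_face_prod: "block_split A (face_prod G K) = face_prod (block_split A G) K"
proof (induction G)
  case (Cons B G)
  have "block_split {} K = []"
    by (induction K) auto
  with Cons show ?case
    by (auto simp: block_split_block_split)
qed simp

lemma face_prod_assoc: "face_prod (face_prod F G) K = face_prod F (face_prod G K)"
  by (induction F) (auto simp: block_split_face_prod)

lemma set_face_prod:
  "set (face_prod F G) = {A \<inter> B | A B. A \<in> set F \<and> B \<in> set G \<and> A \<inter> B \<noteq> {}}"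
  unfolding face_prod_def by auto

lemma refines_trans: "refines F G \<Longrightarrow> refines G H \<Longrightarrow> refines F H"
  unfolding refines_def by (meson order_trans)

lemma refines_face_prod_left: "refines (face_prod F G) F"
  by (auto simp: refines_def set_face_prod)

lemma refines_face_prod_right: "refines (face_prod F G) G"
  by (auto simp: refines_def set_face_prod)

lemma block_split_disjoint: "\<forall>B\<in>set G. A \<inter> B = {} \<Longrightarrow> block_split A G = []"
  by (induction G) auto

lemma block_split_eq_single:
  assumes "sorted_wrt disjnt G" "B \<in> set G" "A \<subseteq> B" "A \<noteq> {}"
  shows "block_split A G = [A]"
  using assms
proof (induction G)
  case (Cons C G)
  show ?case
  proof (cases "B = C")
    case True
    then have "\<forall>B\<in>set G. A \<inter> B = {}"
      using Cons.prems by (auto simp: disjnt_iff)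
    then show ?thesis
      using Cons.prems True by (simp add: block_split_disjoint inf_absorb1)
  next
    case False
    then have "A \<inter> C = {}" "B \<in> set G"
      using Cons.prems by (auto simp: disjnt_iff)
    then show ?thesis using Cons by simp
  qed
qed simp

section \<open>Refinement and the number of blocks of a product\<close>

lemma Union_block_split: "\<Union>(set (block_split A G)) = A \<inter> \<Union>(set G)"
  by (induction G) auto

lemma block_split_nonempty:
  assumes "A \<subseteq> \<Union>(set G)" "A \<noteq> {}"
  shows "block_split A G \<noteq> []"
proof
  assume "block_split A G = []"
  with Union_block_split[of A G] assms show False by auto
qed

text \<open>A single piece would be all of A, since the pieces cover A, and would then lie in one
  block of G.\<close>

lemma length_block_split_ge_2:
  assumes "A \<subseteq> \<Union>(set G)" "A \<noteq> {}" "\<not> (\<exists>B\<in>set G. A \<subseteq> B)"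
  shows "length (block_split A G) \<ge> 2"
proof (rule ccontr)
  assume "\<not> length (block_split A G) \<ge> 2"
  moreover have "length (block_split A G) \<noteq> 0"
    using block_split_nonempty[OF assms(1,2)] by simp
  ultimately have "length (block_split A G) = 1"
    by linarith
  then obtain C where C: "block_split A G = [C]"
    by (auto simp: length_Suc_conv)
  then have "C \<in> set (block_split A G)" by simp
  then have "\<exists>B\<in>set G. C = A \<inter> B"
    by (auto simp: block_split_def)
  moreover have "C = A"
    using Union_block_split[of A G] assms(1) C by auto
  ultimately show False using assms(3) by auto
qed

lemma face_prod_eq_left_if_refines:
  assumes "F \<in> faces n" "G \<in> faces n" "refines F G"
  shows "face_prod F G = F"
proof -
  \<comment> \<open>The tail of a face is in general not a face of the same set, so the induction
    runs over lists of blocks of F while the hypotheses on F stay fixed.\<close>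
  have "face_prod F' G = F'" if "set F' \<subseteq> set F" for F'
    using that
  proof (induction F')
    case (Cons A F')
    obtain B where "B \<in> set G" "A \<subseteq> B"
      using Cons.prems assms(3) by (auto simp: refines_def)
    then have "block_split A G = [A]"
      using Cons.prems assms(1,2) by (intro block_split_eq_single) (auto simp: faces_iff)
    with Cons show ?case by simp
  qed simp
  then show ?thesis by simp
qed

text \<open>Each block of F leaves at least one piece, and a block contained in no block of G leaves
  at least two. This makes right multiplication triangular with respect to the number of
  blocks.\<close>

lemma length_face_prod_if_not_refines:
  assumes "F \<in> faces n" "G \<in> faces n" "\<not> refines F G"
  shows "length (face_prod F G) > length F"
proof -
  have "length (face_prod F' G) \<ge> length F' \<and>
      (\<not> refines F' G \<longrightarrow> length (face_prod F' G) > length F')" if "set F' \<subseteq> set F" for F'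
    using that
  proof (induction F')
    case (Cons A F')
    have A: "A \<subseteq> \<Union>(set G)" "A \<noteq> {}"
      using Cons.prems assms(1,2) by (auto simp: faces_iff)
    have 1: "length (block_split A G) \<ge> 1"
      using block_split_nonempty[OF A] by (cases "block_split A G") auto
    show ?case
    proof (cases "\<exists>B\<in>set G. A \<subseteq> B")
      case True
      with Cons 1 show ?thesis by (auto simp: refines_def)
    next
      case False
      with length_block_split_ge_2[OF A] Cons show ?thesis by (auto simp: refines_def)
    qed
  qed (auto simp: refines_def)
  with assms(3) show ?thesis by blast
qed

lemma face_prod_eq_left_iff:
  assumes "F \<in> faces n" "G \<in> faces n"
  shows "face_prod F G = F \<longleftrightarrow> refines F G"
  using assms face_prod_eq_left_if_refines length_face_prod_if_not_refines by fastforce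

text \<open>For n = 0 the one-block tuple would contain an empty block, so the identity is the empty
  tuple.\<close>

definition one_face :: "nat \<Rightarrow> nat set list" where
  "one_face n = (if n = 0 then [] else [{1..n}])"

lemma one_face_in_faces: "one_face n \<in> faces n"
  by (auto simp: one_face_def faces_iff)

text \<open>Identifies the coefficient \<open>1 gchoose length K\<close> with that of the identity
  element.\<close>

lemma length_le_1_iff_one_face:
  assumes "F \<in> faces n"
  shows "length F \<le> 1 \<longleftrightarrow> F = one_face n"
proof
  assume "length F \<le> 1"
  then consider "F = []" | A where "F = [A]"
    by (cases F) auto
  then show "F = one_face n"
    using assms by cases (auto simp: faces_iff one_face_def split: if_splits)
qed (auto simp: one_face_def)

lemma face_prod_one_face:
  assumes "F \<in> faces n"
  shows "face_prod F (one_face n) = F"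
proof (rule face_prod_eq_left_if_refines[OF assms one_face_in_faces])
  show "refines F (one_face n)"
    using assms by (auto simp: refines_def one_face_def faces_iff)
qed

lemma block_subset: "F \<in> faces n \<Longrightarrow> A \<in> set F \<Longrightarrow> A \<subseteq> {1..n}"
  unfolding faces_iff by blast

lemma block_unique:
  assumes "F \<in> faces n" "A \<in> set F" "B \<in> set F" "x \<in> A" "x \<in> B"
  shows "A = B"
proof -
  obtain i j where ij: "i < length F" "j < length F" "A = F ! i" "B = F ! j"
    using assms(2,3) by (auto simp: in_set_conv_nth)
  then have "i = j"
    using assms(1,4,5) unfolding faces_def by blast
  with ij show ?thesis by simp
qed

lemma distinct_face:
  assumes "F \<in> faces n"
  shows "distinct F"
proof -
  have "distinct F" if "sorted_wrt disjnt F" "\<forall>A\<in>set F. A \<noteq> {}" for F :: "nat set list"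
    using that by (induction F) (auto simp: disjnt_def)
  with assms show ?thesis by (auto simp: faces_iff)
qed

lemma finite_faces [simp]: "finite (faces n)"
proof (rule finite_subset)
  have "length F \<le> 2 ^ n" if "F \<in> faces n" for F
  proof -
    have "length F = card (set F)"
      using distinct_face[OF that] by (simp add: distinct_card)
    also have "\<dots> \<le> card (Pow {1..n})"
      using that by (intro card_mono) (auto simp: faces_iff)
    finally show ?thesis by (simp add: card_Pow)
  qed
  then show "faces n \<subseteq> {F. set F \<subseteq> Pow {1..n} \<and> length F \<le> 2 ^ n}"
    using block_subset by blast
qed (simp add: finite_lists_length_le)

lemma face_type_in_compositions:
  assumes "F \<in> faces n"
  shows "face_type F \<in> compositions n"
proof -
  have "sum_list (map card F) = card (\<Union>(set F))"
    if "sorted_wrt disjnt F" "\<forall>A\<in>set F. finite A" for F :: "nat set list"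
    using that
  proof (induction F)
    case (Cons A F)
    then have "A \<inter> \<Union>(set F) = {}" by (auto simp: disjnt_iff)
    with Cons show ?case by (simp add: card_Un_disjoint)
  qed simp
  moreover have fin: "finite A" if "A \<in> set F" for A
    using block_subset[OF assms that] by (rule finite_subset) simp
  ultimately show ?thesis
    using assms by (auto simp: compositions_def face_type_def faces_iff card_gt_0_iff)
qed

lemma length_le_of_compositions: "\<beta> \<in> compositions n \<Longrightarrow> length \<beta> \<le> n"
proof -
  have "(\<forall>b\<in>set \<beta>. b > 0) \<Longrightarrow> length \<beta> \<le> sum_list \<beta>" for \<beta> :: "nat list"
    by (induction \<beta>) auto
  then show "\<beta> \<in> compositions n \<Longrightarrow> length \<beta> \<le> n"
    by (auto simp: compositions_def)
qed

lemma length_face_le: "F \<in> faces n \<Longrightarrow> length F \<le> n"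
  using length_le_of_compositions[OF face_type_in_compositions] by (simp add: face_type_def)

section \<open>Knapsack numbers under refinement\<close>

lemma knapsack_mono:
  assumes "refines F F'"
  shows "knapsack n \<alpha> F' \<le> knapsack n \<alpha> F"
  unfolding knapsack_def by (intro card_mono) (auto intro: refines_trans[OF assms])

text \<open>The newly counted face is G itself: the product refines G while F does not, and whatever
  F refines is refined by the product. The strict increase moves such terms to the next step of the
  filtration.\<close>

lemma knapsack_face_prod_less:
  assumes "G \<in> faces n" "face_type G = \<alpha>" "\<not> refines F G"
  shows "knapsack n \<alpha> F < knapsack n \<alpha> (face_prod F G)"
  unfolding knapsack_def
proof (rule psubset_card_mono)
  have "G \<in> {H \<in> faces n. refines (face_prod F G) H \<and> face_type H = \<alpha>}"
    using assms refines_face_prod_right by auto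
  moreover have "G \<notin> {H \<in> faces n. refines F H \<and> face_type H = \<alpha>}"
    using assms by auto
  moreover have "refines (face_prod F G) H" if "refines F H" for H
    using that refines_face_prod_left refines_trans by blast
  ultimately show "{H \<in> faces n. refines F H \<and> face_type H = \<alpha>}
      \<subset> {H \<in> faces n. refines (face_prod F G) H \<and> face_type H = \<alpha>}"
    by blast
qed simp

section \<open>Faces as fibres of functions\<close>

abbreviation drop_empty :: "nat set list \<Rightarrow> nat set list" where
  "drop_empty L \<equiv> filter (\<lambda>A. A \<noteq> {}) L"

text \<open>Empty fibres are kept, so that the position of an entry is the function value and g can
  be recovered on S.\<close>

definition fibres :: "nat set \<Rightarrow> nat \<Rightarrow> (nat \<Rightarrow> nat) \<Rightarrow> nat set list" where
  "fibres S N g = map (\<lambda>j. {x\<in>S. g x = j}) [0..<N]"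

definition fibre_face :: "nat \<Rightarrow> nat \<Rightarrow> (nat \<Rightarrow> nat) \<Rightarrow> nat set list" where
  "fibre_face n N g = drop_empty (fibres {1..n} N g)"

text \<open>A list of this kind is determined by the positions of its nonempty entries. Splitting on
  whether the first entry is empty gives Pascal's rule.\<close>

lemma card_drop_empty_fibre:
  assumes "\<forall>A\<in>set G. A \<noteq> {}"
  shows "finite {L. length L = N \<and> drop_empty L = G} \<and>
    card {L. length L = N \<and> drop_empty L = G} = N choose length G"
  using assms
proof (induction N arbitrary: G)
  case 0
  then show ?case by (cases G) (auto cong: conj_cong)
next
  case (Suc N)
  let ?S = "\<lambda>N G. {L. length L = N \<and> drop_empty L = G}"
  show ?case
  proof (cases G)
    case Nil
    have "?S (Suc N) [] = Cons {} ` ?S N []"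
      by (auto simp: length_Suc_conv image_iff split: if_splits)
    then show ?thesis
      using Suc.IH[of "[]"] Nil by (simp add: card_image)
  next
    case (Cons A G')
    have A: "A \<noteq> {}" using Cons Suc.prems by simp
    have eq: "?S (Suc N) G = Cons {} ` ?S N G \<union> Cons A ` ?S N G'"
    proof (intro equalityI subsetI)
      fix L assume "L \<in> ?S (Suc N) G"
      then obtain B L' where "L = B # L'" "length L' = N" "drop_empty (B # L') = G"
        by (auto simp: length_Suc_conv)
      then show "L \<in> Cons {} ` ?S N G \<union> Cons A ` ?S N G'"
        using Cons by (cases "B = {}") auto
    next
      fix L assume "L \<in> Cons {} ` ?S N G \<union> Cons A ` ?S N G'"
      then show "L \<in> ?S (Suc N) G" using A Cons by auto
    qed
    from A have "Cons {} ` ?S N G \<inter> Cons A ` ?S N G' = {}"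
      by blast
    moreover have "finite (?S N G)" "card (?S N G) = N choose Suc (length G')"
        "finite (?S N G')" "card (?S N G') = N choose length G'"
      using Suc.IH[of G] Suc.IH[of G'] Suc.prems Cons by auto
    ultimately have "finite (?S (Suc N) G)"
        "card (?S (Suc N) G) = (N choose Suc (length G')) + (N choose length G')"
      unfolding eq by (simp_all add: card_Un_disjoint card_image)
    then show ?thesis using Cons by simp
  qed
qed

lemma fibre_face_in_faces:
  assumes "g \<in> {1..n} \<rightarrow> {..<N}"
  shows "fibre_face n N g \<in> faces n"
proof -
  have "sorted_wrt disjnt (fibres {1..n} N g)"
    by (auto simp: fibres_def sorted_wrt_iff_nth_less disjnt_iff)
  then have "sorted_wrt disjnt (fibre_face n N g)"
    by (simp add: fibre_face_def sorted_wrt_filter)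
  moreover have "\<Union>(set (fibre_face n N g)) = {1..n}"
    using assms by (fastforce simp: fibre_face_def fibres_def Pi_iff)
  ultimately show ?thesis
    by (auto simp: faces_iff fibre_face_def)
qed

text \<open>Functions correspond bijectively to their lists of N fibres, which here are the lists of
  length N that become G once the empty entries are dropped.\<close>

lemma card_fibre_face_eq:
  assumes G: "G \<in> faces n"
  shows "card {g \<in> {1..n} \<rightarrow>\<^sub>E {..<N}. fibre_face n N g = G} = N choose length G"
proof -
  let ?D = "{g \<in> {1..n} \<rightarrow>\<^sub>E {..<N}. fibre_face n N g = G}"
  let ?L = "{L. length L = N \<and> drop_empty L = G}"
  have "bij_betw (fibres {1..n} N) ?D ?L"
  proof (rule bij_betwI')
    fix g h assume g: "g \<in> ?D" and h: "h \<in> ?D"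
    show "fibres {1..n} N g = fibres {1..n} N h \<longleftrightarrow> g = h"
    proof
      assume eq: "fibres {1..n} N g = fibres {1..n} N h"
      have "g x = h x" if "x \<in> {1..n}" for x
      proof -
        have "g x < N" using g that by auto
        then have "{y\<in>{1..n}. g y = g x} = {y\<in>{1..n}. h y = g x}"
          using eq by (auto simp: fibres_def)
        moreover have "x \<in> {y\<in>{1..n}. g y = g x}" using that by simp
        ultimately have "x \<in> {y\<in>{1..n}. h y = g x}" by blast
        then show ?thesis by simp
      qed
      then show "g = h"
        using g h by (intro PiE_ext[of _ "{1..n}" "\<lambda>_. {..<N}"]) auto
    qed simp
  next
    fix g assume "g \<in> ?D"
    then show "fibres {1..n} N g \<in> ?L" by (auto simp: fibre_face_def fibres_def)
  next
    fix L assume L: "L \<in> ?L"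
    have *: "sorted_wrt disjnt (drop_empty L) \<Longrightarrow> sorted_wrt disjnt L" for L :: "nat set list"
      by (induction L) (auto simp: disjnt_iff split: if_splits)
    have disj: "sorted_wrt disjnt L"
      by (rule *) (use L G in \<open>simp add: faces_iff\<close>)
    have "\<Union>(set L) = \<Union>(set (drop_empty L))"
      by auto
    also have "\<dots> = {1..n}"
      using L G by (simp add: faces_iff del: set_filter)
    finally have un: "\<Union>(set L) = {1..n}" .
    \<comment> \<open>The function with fibre list L sends x to the index of the entry containing x,
      unique by disjointness.\<close>
    have "\<exists>j<N. x \<in> L ! j" if "x \<in> {1..n}" for x
    proof -
      from that un have "x \<in> \<Union>(set L)" by simp
      then show ?thesis using L by (auto simp: in_set_conv_nth)
    qed
    then obtain f where f: "\<And>x. x \<in> {1..n} \<Longrightarrow> f x < N \<and> x \<in> L ! f x"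
      by metis
    define g where "g = restrict f {1..n}"
    have uniq: "i = j" if "i < N" "j < N" "x \<in> L ! i" "x \<in> L ! j" for i j x
      using disj L that by (cases i j rule: linorder_cases)
        (auto simp: sorted_wrt_iff_nth_less disjnt_iff)
    have "L = fibres {1..n} N g"
    proof (rule nth_equalityI)
      fix j assume j: "j < length L"
      then have "L ! j \<subseteq> {1..n}" using un nth_mem by blast
      then show "L ! j = fibres {1..n} N g ! j"
        using j L f uniq by (fastforce simp: fibres_def g_def)
    qed (use L in \<open>auto simp: fibres_def\<close>)
    moreover have "g \<in> {1..n} \<rightarrow>\<^sub>E {..<N}"
      using f by (auto simp: g_def)
    ultimately show "\<exists>g\<in>?D. L = fibres {1..n} N g"
      using L by (intro bexI[of _ g]) (auto simp: fibre_face_def)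
  qed
  then have "card ?D = card ?L" by (rule bij_betw_same_card)
  also have "\<dots> = N choose length G"
    using card_drop_empty_fibre G by (auto simp: faces_iff)
  finally show ?thesis .
qed

lemma drop_empty_block_split: "block_split A (drop_empty L) = drop_empty (map ((\<inter>) A) L)"
  by (induction L) auto

text \<open>Empty entries may be dropped after intersecting instead of before, so products of fibre
  faces can be computed on the full lists of fibres.\<close>

lemma face_prod_drop_empty:
  "face_prod (drop_empty L) (drop_empty L') =
    drop_empty (concat (map (\<lambda>A. map ((\<inter>) A) L') L))"
  by (induction L) (auto simp: drop_empty_block_split)

text \<open>Pairs (i, j) in lexicographic order are the numbers i * M + j in increasing order; the
  block order of \<open>face_prod\<close> thus matches the encoding of pairs.\<close>

lemma concat_map_upt_mult:
  "concat (map (\<lambda>i. map (\<lambda>j. f (i * M + j)) [0..<M]) [0..<N]) = map f [0..<N * M]"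
proof (induction N)
  case (Suc N)
  have "map (\<lambda>j. f (N * M + j)) [0..<M] = map f [N * M..<N * M + M]"
    by (rule nth_equalityI) auto
  with Suc show ?case
    by (simp add: add.commute[of M] upt_add_eq_append[of 0 "N * M" M])
qed simp

text \<open>As h takes values below M, the values of g and h are quotient and remainder of the
  encoded value by M. So the fibres of the encoded function are the intersections of fibres of g and
  of h, in the right order.\<close>

lemma face_prod_fibre_face:
  assumes "h \<in> {1..n} \<rightarrow> {..<M}"
  shows "face_prod (fibre_face n N g) (fibre_face n M h) =
    fibre_face n (N * M) (\<lambda>x. g x * M + h x)"
proof -
  have "{x\<in>{1..n}. g x = i} \<inter> {x\<in>{1..n}. h x = j} =
      {x\<in>{1..n}. g x * M + h x = i * M + j}" if "j < M" for i j
  proof -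
    have "g x = i \<and> h x = j" if "g x * M + h x = i * M + j" "x \<in> {1..n}" for x
    proof -
      have "h x < M" using assms that by auto
      then have "g x = (g x * M + h x) div M" "h x = (g x * M + h x) mod M"
        using \<open>j < M\<close> by auto
      then show ?thesis
        using \<open>j < M\<close> that(1) by simp
    qed
    then show ?thesis by auto
  qed
  then have *: "concat (map (\<lambda>A. map ((\<inter>) A) (fibres {1..n} M h)) (fibres {1..n} N g)) =
      fibres {1..n} (N * M) (\<lambda>x. g x * M + h x)"
    unfolding fibres_def concat_map_upt_mult[symmetric] map_map comp_def
    by (intro arg_cong[where f = concat] map_cong refl) auto
  show ?thesis
    unfolding fibre_face_def face_prod_drop_empty * ..
qed

lemma sum_card_vimage:
  assumes "finite X" "finite T" "f ` X \<subseteq> T"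
  shows "(\<Sum>y\<in>T. of_nat (card {x\<in>X. f x = y}) * a y) = (\<Sum>x\<in>X. a (f x) :: 'b::comm_semiring_1)"
proof -
  have "(\<Sum>x\<in>X. a (f x)) = (\<Sum>y\<in>T. \<Sum>x\<in>{x\<in>X. f x = y}. a (f x))"
    using sum.group[OF assms, of "\<lambda>x. a (f x)"] by simp
  also have "\<dots> = (\<Sum>y\<in>T. of_nat (card {x\<in>X. f x = y}) * a y)"
    by (intro sum.cong refl) simp
  finally show ?thesis ..
qed

text \<open>Sums weighted by the coefficients of \<open>\<psi>\<^sub>N\<close> become unweighted
  sums over functions.\<close>

lemma sum_faces_choose:
  "(\<Sum>G\<in>faces n. of_nat (N choose length G) * a G) =
   (\<Sum>g\<in>{1..n} \<rightarrow>\<^sub>E {..<N}. a (fibre_face n N g) :: 'b::comm_semiring_1)"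
proof -
  have "(\<Sum>g\<in>{1..n} \<rightarrow>\<^sub>E {..<N}. a (fibre_face n N g)) =
     (\<Sum>G\<in>faces n. of_nat (card {g\<in>{1..n} \<rightarrow>\<^sub>E {..<N}. fibre_face n N g = G}) * a G)"
    by (rule sum_card_vimage[symmetric]) (auto intro!: finite_PiE fibre_face_in_faces)
  also have "\<dots> = (\<Sum>G\<in>faces n. of_nat (N choose length G) * a G)"
    using card_fibre_face_eq by (intro sum.cong refl) auto
  finally show ?thesis ..
qed

text \<open>Coefficients in \<open>\<psi>\<^sub>N \<psi>\<^sub>M = \<psi>\<^bsub>NM\<^esub>\<close>: \<open>\<psi>\<^sub>N\<close> is the sum of the fibre faces of all functions
  \<open>{1..n} \<rightarrow> {..<N}\<close>, and a pair of functions is encoded as one function.\<close>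

lemma sum_face_prod_choose:
  assumes "K \<in> faces n"
  shows "(\<Sum>F\<in>faces n. of_nat (N choose length F) *
      (\<Sum>G\<in>faces n. of_nat (M choose length G) * of_bool (face_prod F G = K))) =
    (of_nat ((N * M) choose length K) :: 'b::comm_semiring_1)"
proof -
  let ?P = "\<lambda>N. {1..n} \<rightarrow>\<^sub>E {..<N::nat}"
  have "(\<Sum>F\<in>faces n. of_nat (N choose length F) *
      (\<Sum>G\<in>faces n. of_nat (M choose length G) * of_bool (face_prod F G = K))) =
    (\<Sum>g\<in>?P N. \<Sum>h\<in>?P M. of_bool (face_prod (fibre_face n N g) (fibre_face n M h) = K) :: 'b)"
    unfolding sum_faces_choose ..
  also have "\<dots> = (\<Sum>(g, h)\<in>?P N \<times> ?P M.
      of_bool (fibre_face n (N * M) (\<lambda>x. g x * M + h x) = K))"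
    unfolding sum.cartesian_product[symmetric]
    by (intro sum.cong refl) (simp add: face_prod_fibre_face PiE_def)
  also have "\<dots> = (\<Sum>k\<in>?P (N * M). of_bool (fibre_face n (N * M) k = K))"
  proof (rule sum.reindex_bij_witness[where
        i = "\<lambda>k. (\<lambda>x\<in>{1..n}. k x div M, \<lambda>x\<in>{1..n}. k x mod M)" and
        j = "\<lambda>(g, h). (\<lambda>x\<in>{1..n}. g x * M + h x)"], goal_cases)
    case (1 p)
    obtain g h where p: "p = (g, h)" by (cases p)
    have "(g x * M + h x) div M = g x" if "x \<in> {1..n}" for x
    proof -
      have "h x < M" using 1 p that by auto
      then show ?thesis by simp
    qed
    then have "(\<lambda>x\<in>{1..n}. (\<lambda>x\<in>{1..n}. g x * M + h x) x div M) = g"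
      using 1 p by (auto simp: fun_eq_iff PiE_def Pi_iff extensional_def)
    moreover have "(\<lambda>x\<in>{1..n}. (\<lambda>x\<in>{1..n}. g x * M + h x) x mod M) = h"
      using 1 p by (auto simp: fun_eq_iff PiE_def Pi_iff extensional_def)
    ultimately show ?case using p by simp
  next
    case (2 p)
    obtain g h where p: "p = (g, h)" by (cases p)
    have "g x * M + h x < N * M" if "x \<in> {1..n}" for x
    proof -
      have "g x < N" "h x < M" using 2 p that by auto
      then have "g x * M + h x < (g x + 1) * M" "(g x + 1) * M \<le> N * M"
        by (simp, intro mult_right_mono) auto
      then show ?thesis by linarith
    qed
    then show ?case using p by auto
  next
    case (3 k)
    then show ?case by (auto simp: fun_eq_iff PiE_def Pi_iff extensional_def)
  next
    case (4 k)
    then have "k x < N * M" if "x \<in> {1..n}" for x using that by auto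
    \<comment> \<open>Division by M is meaningful as soon as there is a point x: a value below N * M
      exists only if M is positive.\<close>
    moreover from this have "M > 0" if "x \<in> {1..n}" for x
      using that by (cases M) auto
    ultimately show ?case
      by (auto simp: less_mult_imp_div_less)
  next
    case (5 p)
    have "fibres {1..n} N' (restrict f {1..n}) = fibres {1..n} N' f" for N' f
      by (auto simp: fibres_def)
    then show ?case by (cases p) (simp add: fibre_face_def)
  qed
  also have "\<dots> = (\<Sum>G\<in>faces n. of_nat ((N * M) choose length G) * of_bool (G = K))"
    unfolding sum_faces_choose ..
  also have "\<dots> = of_nat ((N * M) choose length K)"
    using assms by (subst sum.remove[of _ K]) auto
  finally show ?thesis .
qed

text \<open>F refines the fibre face of g exactly when g is constant on the blocks of F, and such g
  amount to an arbitrary choice of one of N values per block. Being a power of N, the result can be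
  evaluated at -1.\<close>

lemma sum_refines_choose:
  assumes F: "F \<in> faces n"
  shows "(\<Sum>G\<in>faces n. of_nat (N choose length G) * of_bool (refines F G)) =
    (of_nat N ^ length F :: 'b::comm_semiring_1)"
proof -
  let ?P = "{1..n} \<rightarrow>\<^sub>E {..<N}"
  let ?C = "{g \<in> ?P. refines F (fibre_face n N g)}"
  have nonempty: "A \<noteq> {}" if "A \<in> set F" for A
    using F that by (simp add: faces_iff)
  note sub = block_subset[OF F] and disj = block_unique[OF F]
  have "\<exists>A. A \<in> set F \<and> x \<in> A" if "x \<in> {1..n}" for x
    using F that unfolding faces_iff by blast
  then obtain bl where bl: "\<And>x. x \<in> {1..n} \<Longrightarrow> bl x \<in> set F \<and> x \<in> bl x"
    by metis
  obtain el where el: "\<And>A. A \<in> set F \<Longrightarrow> el A \<in> A"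
    using nonempty by (metis ex_in_conv)
  have bl_eq: "bl x = A" if "A \<in> set F" "x \<in> A" for A x
    using bl disj sub that by blast
  \<comment> \<open>\<open>el (bl x)\<close> is the chosen representative of the block of x, so the
    right-hand side expresses constancy on blocks.\<close>
  have iff: "refines F (fibre_face n N g) \<longleftrightarrow> (\<forall>x\<in>{1..n}. g x = g (el (bl x)))"
    if "g \<in> ?P" for g
  proof
    assume r: "refines F (fibre_face n N g)"
    show "\<forall>x\<in>{1..n}. g x = g (el (bl x))"
    proof
      fix x assume x: "x \<in> {1..n}"
      with r bl obtain j where "bl x \<subseteq> {y\<in>{1..n}. g y = j}"
        by (fastforce simp: refines_def fibre_face_def fibres_def)
      then show "g x = g (el (bl x))" using bl[OF x] el by blast
    qed
  next
    assume c: "\<forall>x\<in>{1..n}. g x = g (el (bl x))"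
    show "refines F (fibre_face n N g)"
      unfolding refines_def
    proof
      fix A assume A: "A \<in> set F"
      let ?B = "{y\<in>{1..n}. g y = g (el A)}"
      have "el A \<in> {1..n}" using A el sub by blast
      then have "g (el A) < N" using that by auto
      then have "?B \<in> set (fibre_face n N g)"
        using \<open>el A \<in> {1..n}\<close> by (auto simp: fibre_face_def fibres_def)
      moreover have "A \<subseteq> ?B"
      proof
        fix x assume "x \<in> A"
        then show "x \<in> ?B" using c sub[OF A] bl_eq[OF A] by auto
      qed
      ultimately show "\<exists>B\<in>set (fibre_face n N g). A \<subseteq> B" by blast
    qed
  qed
  have "bij_betw (\<lambda>g. \<lambda>A\<in>set F. g (el A)) ?C (set F \<rightarrow>\<^sub>E {..<N})"
  proof (rule bij_betw_byWitness[where f' = "\<lambda>k. \<lambda>x\<in>{1..n}. k (bl x)"], goal_cases)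
    case 1
    show ?case
    proof
      fix g assume g: "g \<in> ?C"
      then have "\<forall>x\<in>{1..n}. g x = g (el (bl x))" using iff by blast
      then show "(\<lambda>x\<in>{1..n}. (\<lambda>A\<in>set F. g (el A)) (bl x)) = g"
        using g bl by (auto simp: fun_eq_iff PiE_def extensional_def)
    qed
  next
    case 2
    have "(\<lambda>A\<in>set F. (\<lambda>x\<in>{1..n}. k (bl x)) (el A)) = k" if "k \<in> set F \<rightarrow>\<^sub>E {..<N}" for k
    proof
      fix A
      show "(\<lambda>A\<in>set F. (\<lambda>x\<in>{1..n}. k (bl x)) (el A)) A = k A"
      proof (cases "A \<in> set F")
        case True
        then have "el A \<in> {1..n}" "bl (el A) = A"
          using el sub bl_eq by blast+
        with True show ?thesis by simp
      qed (use that in \<open>auto simp: PiE_def extensional_def\<close>)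
    qed
    then show ?case by blast
  next
    case 3
    then show ?case
      using el sub by (fastforce simp: PiE_def Pi_iff)
  next
    case 4
    show ?case
    proof (rule image_subsetI)
      fix k assume k: "k \<in> set F \<rightarrow>\<^sub>E {..<N}"
      let ?g = "\<lambda>x\<in>{1..n}. k (bl x)"
      have g: "?g \<in> ?P" using k bl by auto
      have "?g x = ?g (el (bl x))" if x: "x \<in> {1..n}" for x
      proof -
        have "el (bl x) \<in> bl x" "bl x \<in> set F" using bl[OF x] el by auto
        then have "el (bl x) \<in> {1..n}" "bl (el (bl x)) = bl x"
          using sub bl_eq by blast+
        with x show ?thesis by simp
      qed
      with g iff[OF g] show "?g \<in> ?C" by blast
    qed
  qed
  then have "card ?C = card (set F \<rightarrow>\<^sub>E {..<N})"
    by (rule bij_betw_same_card)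
  also have "\<dots> = N ^ length F"
    using distinct_face[OF F] by (simp add: card_PiE distinct_card)
  finally have card: "card ?C = N ^ length F" .
  have fin: "finite ?P" by (simp add: finite_PiE)
  show ?thesis
    unfolding sum_faces_choose using card fin
    by (simp add: of_bool_def sum.If_cases Int_def flip: of_nat_power)
qed

section \<open>Evaluation at minus one\<close>

lemma gchoose_eq_poly:
  obtains p where "\<And>x. poly p x = (x gchoose k :: 'a::field_char_0)"
proof
  show "poly (Polynomial.smult (1 / fact k) (\<Prod>i<k. [:- of_nat i, 1:])) x = x gchoose k" for x :: 'a
    by (simp add: poly_prod gbinomial_prod_rev lessThan_atLeast0)
qed

lemma poly_eq_if_eq_on_nats:
  fixes p q :: "'a::field_char_0 poly"
  assumes "\<And>N::nat. poly p (of_nat N) = poly q (of_nat N)"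
  shows "p = q"
proof (rule ccontr)
  assume "p \<noteq> q"
  then have "finite {x. poly (p - q) x = 0}"
    by (intro poly_roots_finite) simp
  moreover have "range of_nat \<subseteq> {x. poly (p - q) x = 0}"
    using assms by auto
  ultimately have "finite (range (of_nat :: nat \<Rightarrow> 'a))"
    by (rule rev_finite_subset)
  then show False
    using infinite_UNIV_nat by (simp add: finite_image_iff inj_of_nat)
qed

text \<open>Both sides are polynomials in x, and in characteristic 0 the natural numbers are
  infinitely many points of agreement. This carries the counting identities over to x = -1.\<close>

lemma sum_gchoose_eq_poly:
  fixes a :: "'i \<Rightarrow> 'a::field_char_0"
  assumes "\<And>N::nat. (\<Sum>i\<in>I. of_nat (N choose k i) * a i) = poly q (of_nat N)"
  shows "(\<Sum>i\<in>I. (x gchoose k i) * a i) = poly q x"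
proof -
  obtain P where P: "\<And>k x. poly (P k) x = (x gchoose k :: 'a)"
    using gchoose_eq_poly by metis
  have eq: "poly (\<Sum>i\<in>I. P (k i) * [:a i:]) x = (\<Sum>i\<in>I. (x gchoose k i) * a i)" for x
    by (simp add: poly_sum P mult.commute)
  have "(\<Sum>i\<in>I. P (k i) * [:a i:]) = q"
    using assms by (intro poly_eq_if_eq_on_nats) (simp only: eq binomial_gbinomial)
  with eq show ?thesis by metis
qed

text \<open>The numerator (-1)(-2)...(-k) is (-1)^k times k!. The signs of \<open>w0_tilde\<close>
  are thus binomial coefficients at -1, up to the global factor (-1)^n.\<close>

lemma minus_one_gchoose: "(- 1 :: 'a::field_char_0) gchoose k = (-1) ^ k"
proof -
  have "(of_nat k :: 'a) gchoose k = 1"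
    by (simp flip: binomial_gbinomial)
  then show ?thesis
    using gbinomial_minus[of "1::'a" k] by simp
qed

lemma one_gchoose: "(1 :: 'a::field_char_0) gchoose k = of_bool (k \<le> 1)"
proof -
  have "(1::'a) gchoose k = of_nat (1 choose k)"
    by (simp add: binomial_gbinomial)
  also have "1 choose k = of_bool (k \<le> 1)"
    by (cases "k = 0 \<or> k = 1") auto
  finally show ?thesis by simp
qed

definition face_sign :: "nat \<Rightarrow> nat set list \<Rightarrow> 'a::ring_1" where
  "face_sign n F = (-1) ^ (n - length F)"

text \<open>Since a face has at most n blocks, the subtraction is exact, and n - l and n + l have
  the same parity.\<close>

lemma face_sign_eq:
  assumes "F \<in> faces n"
  shows "(face_sign n F :: 'a::ring_1) = (-1) ^ n * (-1) ^ length F"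
  using length_face_le[OF assms] by (auto simp: face_sign_def minus_one_power_iff)

text \<open>This is \<open>sum_refines_choose\<close> at N = -1, multiplied by (-1)^n; it produces
  the sign of the signed knapsack number.\<close>

lemma sum_face_sign_refines:
  assumes F: "F \<in> faces n"
  shows "(\<Sum>G\<in>faces n. face_sign n G * of_bool (refines F G)) =
    (face_sign n F :: 'a::field_char_0)"
proof -
  have "(\<Sum>G\<in>faces n. (- 1 gchoose length G) * of_bool (refines F G)) =
      poly (Polynomial.monom 1 (length F)) (- 1 :: 'a)"
    by (rule sum_gchoose_eq_poly) (simp add: sum_refines_choose[OF F] poly_monom)
  then have "(\<Sum>G\<in>faces n. (-1) ^ length G * of_bool (refines F G)) = (-1 :: 'a) ^ length F"
    by (simp add: minus_one_gchoose poly_monom)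
  moreover have "(\<Sum>G\<in>faces n. face_sign n G * of_bool (refines F G)) =
      (-1) ^ n * (\<Sum>G\<in>faces n. (-1) ^ length G * of_bool (refines F G) :: 'a)"
    unfolding sum_distrib_left by (intro sum.cong refl) (simp add: face_sign_eq mult.assoc)
  ultimately show ?thesis
    using F by (simp add: face_sign_eq)
qed

text \<open>Substituting N = M = -1 in \<open>sum_face_prod_choose\<close> turns N * M into 1, and
  \<open>1 gchoose length K\<close> detects the identity. The two variables are specialised one
  after the other.\<close>

lemma sum_face_sign_face_prod:
  assumes K: "K \<in> faces n"
  shows "(\<Sum>F\<in>faces n. \<Sum>G\<in>faces n. face_sign n F * face_sign n G * of_bool (face_prod F G = K)) =
    (of_bool (K = one_face n) :: 'a::field_char_0)"
proof -
  let ?b = "\<lambda>F G. of_bool (face_prod F G = K) :: 'a"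
  obtain p where p: "\<And>x. poly p x = (x gchoose length K :: 'a)"
    using gchoose_eq_poly by blast
  \<comment> \<open>Here N becomes -1 while M is still natural; as a polynomial in N the right-hand
    side is p evaluated at N * M.\<close>
  have 1: "(\<Sum>F\<in>faces n. (- 1 gchoose length F) *
      (\<Sum>G\<in>faces n. of_nat (M choose length G) * ?b F G)) = (- of_nat M) gchoose length K"
    for M
  proof -
    have "(\<Sum>F\<in>faces n. (- 1 gchoose length F) *
        (\<Sum>G\<in>faces n. of_nat (M choose length G) * ?b F G)) =
        poly (pcompose p [:0, of_nat M:]) (- 1)"
      by (rule sum_gchoose_eq_poly)
        (simp only: sum_face_prod_choose[OF K], simp add: poly_pcompose p binomial_gbinomial)
    then show ?thesis by (simp add: poly_pcompose p)
  qed
  \<comment> \<open>Exchanging the sums puts the coefficients depending on M outermost, as the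
    second substitution requires.\<close>
  have swap: "(\<Sum>F\<in>faces n. u F * (\<Sum>G\<in>faces n. v G * ?b F G)) =
      (\<Sum>G\<in>faces n. v G * (\<Sum>F\<in>faces n. u F * ?b F G))" for u v
    unfolding sum_distrib_left by (subst sum.swap) (simp add: mult.left_commute)
  \<comment> \<open>Now M becomes -1 in p(-M), which yields p(1).\<close>
  have "(\<Sum>G\<in>faces n. (- 1 gchoose length G) * (\<Sum>F\<in>faces n. (- 1 gchoose length F) * ?b F G)) =
      poly (pcompose p [:0, -1:]) (- 1)"
    by (rule sum_gchoose_eq_poly)
      (simp only: 1 swap[symmetric], simp add: poly_pcompose p)
  then have val: "(\<Sum>F\<in>faces n. (-1) ^ length F * (\<Sum>G\<in>faces n. (-1) ^ length G * ?b F G)) =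
      1 gchoose length K"
    by (subst swap) (simp add: poly_pcompose p minus_one_gchoose)
  \<comment> \<open>The two global factors (-1)^n cancel.\<close>
  have eq: "face_sign n F * face_sign n G * ?b F G =
      (-1) ^ length F * ((-1) ^ length G * ?b F G)" if "F \<in> faces n" "G \<in> faces n" for F G
    using that by (simp add: face_sign_eq mult_ac flip: power_mult_distrib)
  have "(\<Sum>F\<in>faces n. \<Sum>G\<in>faces n. face_sign n F * face_sign n G * ?b F G) =
      (\<Sum>F\<in>faces n. (-1) ^ length F * (\<Sum>G\<in>faces n. (-1) ^ length G * ?b F G))"
    unfolding sum_distrib_left by (intro sum.cong refl eq)
  also note val
  finally show ?thesis
    unfolding one_gchoose length_le_1_iff_one_face[OF K] .
qed

section \<open>The longest element in the descent algebra\<close>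

lemma comp_partial_sums_Nil [simp]: "comp_partial_sums [] = {}"
  by (auto simp: comp_partial_sums_def)

lemma comp_partial_sums_single [simp]: "comp_partial_sums [b] = {}"
  by (auto simp: comp_partial_sums_def)

lemma comp_partial_sums_Cons:
  assumes "\<beta> \<noteq> []"
  shows "comp_partial_sums (b # \<beta>) = insert b ((+) b ` comp_partial_sums \<beta>)"
proof (intro equalityI subsetI)
  fix x assume "x \<in> comp_partial_sums (b # \<beta>)"
  then obtain i where i: "x = sum_list (take i (b # \<beta>))" "1 \<le> i" "i < length (b # \<beta>)"
    by (auto simp: comp_partial_sums_def)
  then obtain j where j: "i = Suc j" by (cases i) auto
  show "x \<in> insert b ((+) b ` comp_partial_sums \<beta>)"
  proof (cases "j = 0")
    case False
    with i j show ?thesis by (force simp: comp_partial_sums_def)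
  qed (use i j in simp)
next
  fix x assume "x \<in> insert b ((+) b ` comp_partial_sums \<beta>)"
  then consider "x = b" | i where "x = b + sum_list (take i \<beta>)" "1 \<le> i" "i < length \<beta>"
    by (auto simp: comp_partial_sums_def)
  then show "x \<in> comp_partial_sums (b # \<beta>)"
  proof cases
    case 1
    with assms have "x = sum_list (take 1 (b # \<beta>)) \<and> (1::nat) \<le> 1 \<and> 1 < length (b # \<beta>)"
      by simp
    then show ?thesis unfolding comp_partial_sums_def by blast
  next
    case 2
    then have "x = sum_list (take (Suc i) (b # \<beta>)) \<and> 1 \<le> Suc i \<and> Suc i < length (b # \<beta>)"
      by simp
    then show ?thesis unfolding comp_partial_sums_def by blast
  qed
qed

lemma comp_partial_sums_props:
  assumes "\<forall>b\<in>set \<beta>. b > 0"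
  shows "comp_partial_sums \<beta> \<subseteq> {1..<sum_list \<beta>} \<and> finite (comp_partial_sums \<beta>) \<and>
    card (comp_partial_sums \<beta>) = length \<beta> - 1"
  using assms
proof (induction \<beta>)
  case (Cons b \<beta>)
  show ?case
  proof (cases "\<beta> = []")
    case False
    let ?D = "comp_partial_sums \<beta>"
    have IH: "?D \<subseteq> {1..<sum_list \<beta>}" "finite ?D" "card ?D = length \<beta> - 1"
      using Cons by auto
    have "sum_list \<beta> > 0"
      using False Cons.prems by (cases \<beta>) auto
    moreover have "b \<notin> (+) b ` ?D" using IH(1) by auto
    moreover have "length \<beta> > 0" using False by simp
    ultimately show ?thesis
      unfolding comp_partial_sums_Cons[OF False] using IH Cons.prems
      by (auto simp: card_image)
  qed simp
qed simp

lemma comp_partial_sums_inj: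
  assumes "\<forall>b\<in>set \<beta>. b > 0" "\<forall>b\<in>set \<gamma>. b > 0" "sum_list \<beta> = sum_list \<gamma>"
    "comp_partial_sums \<beta> = comp_partial_sums \<gamma>"
  shows "\<beta> = \<gamma>"
  using assms
proof (induction \<beta> arbitrary: \<gamma>)
  case Nil
  then show ?case by (cases \<gamma>) auto
next
  case (Cons b \<beta>)
  then obtain c \<gamma>' where \<gamma>: "\<gamma> = c # \<gamma>'" by (cases \<gamma>) auto
  have len: "length \<beta> = length \<gamma>'"
    using comp_partial_sums_props[OF Cons.prems(1)] comp_partial_sums_props[OF Cons.prems(2)]
      Cons.prems(4) \<gamma> by simp
  show ?case
  proof (cases "\<beta> = []")
    case True
    then show ?thesis using len \<gamma> Cons.prems(3) by simp
  next
    case False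
    then have ne: "\<gamma>' \<noteq> []" using len by auto
    let ?B = "comp_partial_sums \<beta>" and ?C = "comp_partial_sums \<gamma>'"
    have pos: "0 \<notin> ?B" "0 \<notin> ?C"
      using comp_partial_sums_props[of \<beta>] comp_partial_sums_props[of \<gamma>'] Cons.prems(1,2) \<gamma>
      by force+
    have eq: "insert b ((+) b ` ?B) = insert c ((+) c ` ?C)"
      using Cons.prems(4) False ne by (simp add: \<gamma> comp_partial_sums_Cons)
    \<comment> \<open>The two memberships give c \<le> b and b \<le> c: the first part is the least
      partial sum.\<close>
    have "b \<in> insert c ((+) c ` ?C)" "c \<in> insert b ((+) b ` ?B)"
      using eq by blast+
    then have bc: "b = c" by auto
    moreover have "b \<notin> (+) b ` ?B" "b \<notin> (+) b ` ?C" using pos by auto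
    ultimately have "(+) b ` ?B = (+) b ` ?C" using eq by (metis insert_ident)
    then have "?B = ?C" by (simp add: inj_image_eq_iff)
    then have "\<beta> = \<gamma>'"
      using Cons.IH[of \<gamma>'] Cons.prems \<gamma> bc by simp
    with bc \<gamma> show ?thesis by simp
  qed
qed

text \<open>The least element of D becomes the first part, and the remaining elements, shifted down
  by it, are handled by induction.\<close>

lemma comp_partial_sums_surj:
  assumes "D \<subseteq> {1..<n}"
  shows "\<exists>\<beta>\<in>compositions n. comp_partial_sums \<beta> = D"
  using assms
proof (induction n arbitrary: D rule: less_induct)
  case (less n)
  show ?case
  proof (cases "D = {}")
    case True
    show ?thesis
    proof (cases "n = 0")
      case True
      then show ?thesis using \<open>D = {}\<close> by (intro bexI[of _ "[]"]) (auto simp: compositions_def)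
    next
      case False
      then show ?thesis using \<open>D = {}\<close> by (intro bexI[of _ "[n]"]) (auto simp: compositions_def)
    qed
  next
    case False
    have fin: "finite D" using less.prems finite_subset by blast
    define b where "b = Min D"
    have b: "b \<in> D" "\<And>d. d \<in> D \<Longrightarrow> b \<le> d"
      using fin False by (auto simp: b_def)
    have bn: "1 \<le> b" "b < n" using b(1) less.prems by auto
    define D' where "D' = (\<lambda>d. d - b) ` (D - {b})"
    have "D' \<subseteq> {1..<n - b}"
    proof
      fix x assume "x \<in> D'"
      then obtain d where d: "d \<in> D" "d \<noteq> b" "x = d - b" by (auto simp: D'_def)
      moreover have "b \<le> d" "d < n" using b(2) d(1) less.prems by auto
      ultimately show "x \<in> {1..<n - b}" using bn by auto
    qed
    then obtain \<beta> where \<beta>: "\<beta> \<in> compositions (n - b)" "comp_partial_sums \<beta> = D'"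
      using less.IH[of "n - b" D'] bn by auto
    have "\<beta> \<noteq> []" using \<beta>(1) bn by (auto simp: compositions_def)
    moreover have "(+) b ` D' = D - {b}"
      using b(2) by (force simp: D'_def image_image)
    ultimately have "comp_partial_sums (b # \<beta>) = D"
      using b(1) by (auto simp: comp_partial_sums_Cons \<beta>(2))
    moreover have "b # \<beta> \<in> compositions n"
      using \<beta>(1) bn by (auto simp: compositions_def)
    ultimately show ?thesis by blast
  qed
qed

lemma bij_betw_comp_partial_sums:
  "bij_betw comp_partial_sums (compositions n) (Pow {1..<n})"
proof (rule bij_betw_imageI)
  show "inj_on comp_partial_sums (compositions n)"
    using comp_partial_sums_inj by (auto simp: inj_on_def compositions_def)
  have "comp_partial_sums ` compositions n \<subseteq> Pow {1..<n}"
    using comp_partial_sums_props by (fastforce simp: compositions_def)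
  then show "comp_partial_sums ` compositions n = Pow {1..<n}"
    using comp_partial_sums_surj by blast
qed

lemma finite_compositions [simp]: "finite (compositions n)"
  using bij_betw_finite[OF bij_betw_comp_partial_sums] by simp

text \<open>Inclusion-exclusion: in terms of the set of partial sums this is the alternating sum
  over the subsets of the complement of S, which vanishes unless that complement is empty.\<close>

lemma sum_compositions_sign:
  assumes "S \<subseteq> {1..<n}"
  shows "(\<Sum>\<beta>\<in>compositions n. (-1) ^ (n - length \<beta>) * of_bool (S \<subseteq> comp_partial_sums \<beta>)) =
    (of_bool (S = {1..<n}) :: 'a::comm_ring_1)"
proof -
  \<comment> \<open>Of the n - 1 possible cuts, \<beta> uses \<open>length \<beta> - 1\<close>; for
    n = 0 the truncated subtractions make both sides 0.\<close>
  have len: "n - length \<beta> = card ({1..<n} - comp_partial_sums \<beta>)" if "\<beta> \<in> compositions n" for \<beta>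
  proof -
    have *: "comp_partial_sums \<beta> \<subseteq> {1..<n}" "finite (comp_partial_sums \<beta>)"
        "card (comp_partial_sums \<beta>) = length \<beta> - 1"
      using that comp_partial_sums_props[of \<beta>] by (auto simp: compositions_def)
    have "card ({1..<n} - comp_partial_sums \<beta>) = (n - 1) - (length \<beta> - 1)"
      using * by (simp add: card_Diff_subset)
    moreover have "n = 0 \<or> length \<beta> \<ge> 1"
      using that by (cases \<beta>) (auto simp: compositions_def)
    ultimately show ?thesis by auto
  qed
  have "(\<Sum>\<beta>\<in>compositions n. (-1) ^ (n - length \<beta>) * of_bool (S \<subseteq> comp_partial_sums \<beta>)) =
      (\<Sum>\<beta>\<in>compositions n. (\<lambda>D. (-1) ^ card ({1..<n} - D) * of_bool (S \<subseteq> D) :: 'a)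
        (comp_partial_sums \<beta>))"
    using len by (intro sum.cong refl) simp
  also have "\<dots> = (\<Sum>D\<in>Pow {1..<n}. (-1) ^ card ({1..<n} - D) * of_bool (S \<subseteq> D))"
    by (rule sum.reindex_bij_betw[OF bij_betw_comp_partial_sums])
  also have "\<dots> = (\<Sum>D\<in>{D \<in> Pow {1..<n}. S \<subseteq> D}. (-1) ^ card ({1..<n} - D))"
    by (rule sum.mono_neutral_cong_right) auto
  also have "\<dots> = (\<Sum>E\<in>Pow ({1..<n} - S). (-1) ^ card E)"
    by (rule sum.reindex_bij_witness[where i = "\<lambda>E. {1..<n} - E" and j = "\<lambda>D. {1..<n} - D"])
      (use assms in auto)
  \<comment> \<open>Expanding a product of factors 1 - 1 gives the alternating sum over
    subsets.\<close>
  also have "\<dots> = (\<Prod>i\<in>{1..<n} - S. 1 - 1)"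
    by (simp only: prod_diff_conv_sum finite_Diff finite_atLeastLessThan prod.neutral_const mult_1_right)
  also have "\<dots> = of_bool (S = {1..<n})"
  proof (cases "S = {1..<n}")
    case False
    then have "card ({1..<n} - S) \<noteq> 0" using assms by auto
    with False show ?thesis by (simp add: power_0_left)
  qed simp
  finally show ?thesis .
qed

section \<open>The longest element as an alternating sum\<close>

lemma w0_perm_permutes: "w0_perm n permutes {1..n}"
proof (rule bij_imp_permutes)
  show "bij_betw (w0_perm n) {1..n} {1..n}"
    by (rule bij_betw_byWitness[where f' = "w0_perm n"]) (auto simp: w0_perm_def)
qed (auto simp: w0_perm_def)

text \<open>With descents everywhere, counting down from position 1 bounds w i above by n + 1 - i,
  and counting back from position n bounds it below by the same number.\<close>

lemma Des_eq_all_iff_w0_perm: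
  assumes "w permutes {1..n}"
  shows "Des n w = {1..<n} \<longleftrightarrow> w = w0_perm n"
proof
  assume "w = w0_perm n"
  then show "Des n w = {1..<n}"
    by (auto simp: Des_def w0_perm_def)
next
  assume D: "Des n w = {1..<n}"
  have dec: "w (Suc i) < w i" if "1 \<le> i" "i < n" for i
  proof -
    have "i \<in> Des n w" using that D by simp
    then show ?thesis by (simp add: Des_def)
  qed
  have rng: "w i \<in> {1..n}" if "i \<in> {1..n}" for i
    using permutes_in_image[OF assms] that by blast
  have up: "w (Suc i) + i \<le> n" if "i < n" for i
    using that
  proof (induction i)
    case 0
    then show ?case using rng[of 1] by simp
  next
    case (Suc i)
    then show ?case using dec[of "Suc i"] by simp
  qed
  have low: "w (n - i) \<ge> Suc i" if "i < n" for i
    using that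
  proof (induction i)
    case 0
    then show ?case using rng[of n] by simp
  next
    case (Suc i)
    then have "Suc (n - Suc i) = n - i" "1 \<le> n - Suc i" by auto
    then show ?case using Suc dec[of "n - Suc i"] by simp
  qed
  show "w = w0_perm n"
  proof
    fix i
    show "w i = w0_perm n i"
    proof (cases "i \<in> {1..n}")
      case True
      then have "w i \<ge> Suc (n - i)" using low[of "n - i"] by simp
      moreover have "w i + (i - 1) \<le> n" using up[of "i - 1"] True by fastforce
      ultimately show ?thesis using True by (simp add: w0_perm_def)
    next
      case False
      then show ?thesis
        using assms by (auto simp: w0_perm_def permutes_not_in)
    qed
  qed
qed

lemma lookup_sum_lc_of:
  assumes "finite A"
  shows "Poly_Mapping.lookup (\<Sum>x\<in>A. lc_of x) y = (of_bool (y \<in> A) :: 'k::field)"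
  using assms by (simp add: lookup_sum lookup_single when_def)

lemma finite_permutations_Des: "finite {w. w permutes {1..n::nat} \<and> P w}"
  using finite_permutations[of "{1..n}"] by (rule rev_finite_subset) auto

text \<open>The coefficient of w on the right is the alternating sum of
  \<open>sum_compositions_sign\<close> for its descent set, so only a permutation with all descents
  survives.\<close>

lemma w0_eq_sum_B_elem:
  "lc_of (w0_perm n) =
    (\<Sum>\<beta>\<in>compositions n. lc_scale ((-1) ^ (n - length \<beta>)) (B_elem n \<beta> :: _ \<Rightarrow>\<^sub>0 'k::field))"
proof (rule poly_mapping_eqI)
  fix w :: "nat \<Rightarrow> nat"
  have "Poly_Mapping.lookup (\<Sum>\<beta>\<in>compositions n.
        lc_scale ((-1) ^ (n - length \<beta>)) (B_elem n \<beta> :: _ \<Rightarrow>\<^sub>0 'k)) w =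
      (\<Sum>\<beta>\<in>compositions n. (-1) ^ (n - length \<beta>) *
        of_bool (w permutes {1..n} \<and> Des n w \<subseteq> comp_partial_sums \<beta>))"
    unfolding lookup_sum[of _ "compositions n"] lookup_lc_scale B_elem_def
      lookup_sum_lc_of[OF finite_permutations_Des] mem_Collect_eq ..
  also have "\<dots> = of_bool (w = w0_perm n)"
  proof (cases "w permutes {1..n}")
    case True
    have "Des n w \<subseteq> {1..<n}" by (auto simp: Des_def)
    from sum_compositions_sign[OF this, where 'a = 'k] show ?thesis
      unfolding Des_eq_all_iff_w0_perm[OF True] by (simp only: True simp_thms)
  next
    case False
    then show ?thesis using w0_perm_permutes by auto
  qed
  also have "\<dots> = Poly_Mapping.lookup (lc_of (w0_perm n)) w"
    by (auto simp: lookup_single when_def)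
  finally show "Poly_Mapping.lookup (lc_of (w0_perm n)) w = Poly_Mapping.lookup (\<Sum>\<beta>\<in>compositions n.
        lc_scale ((-1) ^ (n - length \<beta>)) (B_elem n \<beta> :: _ \<Rightarrow>\<^sub>0 'k)) w" ..
qed

section \<open>The image of the longest element under \<rho>\<close>

definition w0_tilde :: "nat \<Rightarrow> (nat set list \<Rightarrow>\<^sub>0 'k::field)" where
  "w0_tilde n = (\<Sum>F\<in>faces n. Poly_Mapping.single F (face_sign n F))"

lemma lookup_w0_tilde:
  "Poly_Mapping.lookup (w0_tilde n) F = (if F \<in> faces n then face_sign n F else 0)"
  by (simp add: w0_tilde_def lookup_sum lookup_single when_def)

lemma lookup_B_tilde:
  "Poly_Mapping.lookup (B_tilde n \<beta>) F = (of_bool (F \<in> faces n \<and> face_type F = \<beta>) :: 'k::field)"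
  by (simp add: B_tilde_def lookup_sum_lc_of)

lemma w0_tilde_in_face_algebra: "w0_tilde n \<in> face_algebra n"
  by (auto simp: face_algebra_def in_keys_iff lookup_w0_tilde split: if_splits)

lemma B_tilde_in_face_algebra: "B_tilde n \<beta> \<in> face_algebra n"
  by (auto simp: face_algebra_def in_keys_iff lookup_B_tilde split: if_splits)

text \<open>Linearity of \<rho> is given only on the descent algebra, so membership of the partial
  sums is carried through the induction.\<close>

lemma rho_sum:
  assumes \<rho>: "is_rho n \<rho>" and "finite A" "A \<subseteq> compositions n"
  shows "(\<Sum>\<beta>\<in>A. lc_scale (c \<beta>) (B_elem n \<beta>)) \<in> descent_algebra n \<and>
    \<rho> (\<Sum>\<beta>\<in>A. lc_scale (c \<beta>) (B_elem n \<beta>)) = (\<Sum>\<beta>\<in>A. lc_scale (c \<beta>) (B_tilde n \<beta>))"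
  using assms(2,3)
proof (induction A rule: finite_induct)
  case empty
  have "0 \<in> descent_algebra n"
    by (simp add: descent_algebra_def lc.span_zero)
  then have "\<rho> (lc_scale 0 0) = lc_scale 0 (\<rho> 0)"
    using \<rho> unfolding is_rho_def by blast
  with \<open>0 \<in> descent_algebra n\<close> show ?case by simp
next
  case (insert \<beta> A)
  have B: "B_elem n \<beta> \<in> descent_algebra n"
    using insert.prems by (auto simp: descent_algebra_def intro: lc.span_base)
  then have sB: "lc_scale (c \<beta>) (B_elem n \<beta>) \<in> descent_algebra n"
    unfolding descent_algebra_def by (rule lc.span_scale)
  have "\<rho> (lc_scale (c \<beta>) (B_elem n \<beta>)) = lc_scale (c \<beta>) (\<rho> (B_elem n \<beta>))"
    using \<rho> B unfolding is_rho_def by blast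
  moreover have "\<rho> (B_elem n \<beta>) = B_tilde n \<beta>"
    using \<rho> insert.prems unfolding is_rho_def by blast
  ultimately have \<rho>B: "\<rho> (lc_scale (c \<beta>) (B_elem n \<beta>)) = lc_scale (c \<beta>) (B_tilde n \<beta>)"
    by simp
  let ?S = "\<Sum>\<beta>\<in>A. lc_scale (c \<beta>) (B_elem n \<beta>)"
  have S: "?S \<in> descent_algebra n" "\<rho> ?S = (\<Sum>\<beta>\<in>A. lc_scale (c \<beta>) (B_tilde n \<beta>))"
    using insert by auto
  have "\<rho> (lc_scale (c \<beta>) (B_elem n \<beta>) + ?S) = \<rho> (lc_scale (c \<beta>) (B_elem n \<beta>)) + \<rho> ?S"
    using \<rho> sB S(1) by (simp add: is_rho_def)
  moreover have "lc_scale (c \<beta>) (B_elem n \<beta>) + ?S \<in> descent_algebra n"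
    using sB S(1) by (simp add: descent_algebra_def lc.span_add)
  ultimately show ?case
    using insert.hyps \<rho>B S(2) by simp
qed

text \<open>Each face occurs in \<open>B_tilde n \<beta>\<close> for exactly one \<beta>, its type,
  whose length is the number of its blocks.\<close>

lemma rho_w0:
  assumes "is_rho n \<rho>"
  shows "\<rho> (lc_of (w0_perm n)) = w0_tilde n"
proof -
  have "\<rho> (lc_of (w0_perm n)) =
      (\<Sum>\<beta>\<in>compositions n. lc_scale ((-1) ^ (n - length \<beta>)) (B_tilde n \<beta>))"
    unfolding w0_eq_sum_B_elem using rho_sum[OF assms, of "compositions n"] by simp
  also have "\<dots> = w0_tilde n"
  proof (rule poly_mapping_eqI)
    fix F
    have "Poly_Mapping.lookup
        (\<Sum>\<beta>\<in>compositions n. lc_scale ((-1) ^ (n - length \<beta>)) (B_tilde n \<beta>)) F =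
      (\<Sum>\<beta>\<in>compositions n. if \<beta> = face_type F then
        (-1) ^ (n - length \<beta>) * of_bool (F \<in> faces n) else 0)"
      unfolding lookup_sum by (intro sum.cong refl) (auto simp: lookup_B_tilde)
    also have "\<dots> = Poly_Mapping.lookup (w0_tilde n) F"
      using face_type_in_compositions[of F n]
      by (auto simp: lookup_w0_tilde face_sign_def face_type_def)
    finally show "Poly_Mapping.lookup
        (\<Sum>\<beta>\<in>compositions n. lc_scale ((-1) ^ (n - length \<beta>)) (B_tilde n \<beta>)) F =
      Poly_Mapping.lookup (w0_tilde n) F" .
  qed
  finally show ?thesis .
qed

section \<open>Right multiplication in the face algebra\<close>

lemma face_algebra_lookup_0: "f \<in> face_algebra n \<Longrightarrow> F \<notin> faces n \<Longrightarrow> Poly_Mapping.lookup f F = 0"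
  by (auto simp: face_algebra_def in_keys_iff)

lemma subspace_face_algebra: "lc.subspace (face_algebra n)"
proof (rule lc.subspaceI)
  fix x y :: "nat set list \<Rightarrow>\<^sub>0 'a"
  assume "x \<in> face_algebra n" "y \<in> face_algebra n"
  then show "x + y \<in> face_algebra n"
    using Poly_Mapping.keys_add[of x y] by (auto simp: face_algebra_def)
qed (auto simp: face_algebra_def in_keys_iff)

lemma lookup_face_mult:
  assumes "f \<in> face_algebra n" "g \<in> face_algebra n"
  shows "Poly_Mapping.lookup (f \<star> g) K = (\<Sum>F\<in>faces n. \<Sum>G\<in>faces n.
    Poly_Mapping.lookup f F * Poly_Mapping.lookup g G * of_bool (face_prod F G = K))"
proof -
  have "Poly_Mapping.lookup (f \<star> g) K =
      (\<Sum>F\<in>faces n. \<Sum>G\<in>Poly_Mapping.keys g.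
        Poly_Mapping.lookup f F * Poly_Mapping.lookup g G * of_bool (face_prod F G = K))"
    using assms(1) by (subst face_mult_superset[of "faces n"])
      (auto simp: face_algebra_def lookup_sum lookup_single when_def of_bool_def if_distrib
        cong: if_cong)
  also have "\<dots> = (\<Sum>F\<in>faces n. \<Sum>G\<in>faces n.
        Poly_Mapping.lookup f F * Poly_Mapping.lookup g G * of_bool (face_prod F G = K))"
    using assms(2) by (intro sum.cong sum.mono_neutral_left refl)
      (auto simp: face_algebra_def in_keys_iff)
  finally show ?thesis .
qed

text \<open>The linear extension of b, evaluated at a product; with b an indicator it reduces
  associativity to that of \<open>face_prod\<close>.\<close>

lemma sum_lookup_face_mult:
  assumes "f \<in> face_algebra n" "g \<in> face_algebra n"
  shows "(\<Sum>H\<in>faces n. Poly_Mapping.lookup (f \<star> g) H * b H) =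
    (\<Sum>F\<in>faces n. \<Sum>G\<in>faces n.
      Poly_Mapping.lookup f F * Poly_Mapping.lookup g G * b (face_prod F G))"
proof -
  have "(\<Sum>H\<in>faces n. Poly_Mapping.lookup (f \<star> g) H * b H) =
      (\<Sum>F\<in>faces n. \<Sum>H\<in>faces n. \<Sum>G\<in>faces n.
        Poly_Mapping.lookup f F * Poly_Mapping.lookup g G * of_bool (face_prod F G = H) * b H)"
    unfolding lookup_face_mult[OF assms] sum_distrib_right by (rule sum.swap)
  also have "\<dots> = (\<Sum>F\<in>faces n. \<Sum>G\<in>faces n. \<Sum>H\<in>faces n.
        Poly_Mapping.lookup f F * Poly_Mapping.lookup g G * of_bool (face_prod F G = H) * b H)"
    by (rule sum.cong[OF refl], rule sum.swap)
  also have "\<dots> = (\<Sum>F\<in>faces n. \<Sum>G\<in>faces n.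
      Poly_Mapping.lookup f F * Poly_Mapping.lookup g G * b (face_prod F G))"
  proof (intro sum.cong refl)
    fix F G assume "F \<in> faces n" "G \<in> faces n"
    then have "face_prod F G \<in> faces n" by (rule face_prod_in_faces)
    moreover have "(\<Sum>H\<in>faces n.
        Poly_Mapping.lookup f F * Poly_Mapping.lookup g G * of_bool (face_prod F G = H) * b H) =
      (\<Sum>H\<in>faces n. if H = face_prod F G then
        Poly_Mapping.lookup f F * Poly_Mapping.lookup g G * b H else 0)"
      by (intro sum.cong refl) auto
    ultimately show "(\<Sum>H\<in>faces n.
        Poly_Mapping.lookup f F * Poly_Mapping.lookup g G * of_bool (face_prod F G = H) * b H) =
      Poly_Mapping.lookup f F * Poly_Mapping.lookup g G * b (face_prod F G)"
      by simp
  qed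
  finally show ?thesis .
qed

lemma face_mult_assoc:
  assumes "f \<in> face_algebra n" "g \<in> face_algebra n" "h \<in> face_algebra n"
  shows "f \<star> g \<star> h = f \<star> (g \<star> h)"
proof (rule poly_mapping_eqI)
  fix K
  have "Poly_Mapping.lookup (f \<star> g \<star> h) K = (\<Sum>H\<in>faces n. Poly_Mapping.lookup (f \<star> g) H *
      (\<Sum>E\<in>faces n. Poly_Mapping.lookup h E * of_bool (face_prod H E = K)))"
    using assms by (simp only: lookup_face_mult[of _ n] face_mult_in_face_algebra
        sum_distrib_left mult.assoc)
  also have "\<dots> = (\<Sum>F\<in>faces n. \<Sum>G\<in>faces n. Poly_Mapping.lookup f F * Poly_Mapping.lookup g G *
      (\<Sum>E\<in>faces n. Poly_Mapping.lookup h E * of_bool (face_prod (face_prod F G) E = K)))"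
    by (rule sum_lookup_face_mult[OF assms(1,2)])
  also have "\<dots> = (\<Sum>F\<in>faces n. Poly_Mapping.lookup f F * (\<Sum>G\<in>faces n. \<Sum>E\<in>faces n.
      Poly_Mapping.lookup g G * Poly_Mapping.lookup h E *
        of_bool (face_prod F (face_prod G E) = K)))"
    by (simp only: sum_distrib_left mult.assoc face_prod_assoc)
  also have "\<dots> = (\<Sum>F\<in>faces n. Poly_Mapping.lookup f F * (\<Sum>H\<in>faces n.
      Poly_Mapping.lookup (g \<star> h) H * of_bool (face_prod F H = K)))"
    by (subst sum_lookup_face_mult[OF assms(2,3)]) (rule refl)
  also have "\<dots> = Poly_Mapping.lookup (f \<star> (g \<star> h)) K"
    using assms by (simp only: lookup_face_mult[of f n "g \<star> h"] face_mult_in_face_algebra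
        sum_distrib_left mult.assoc)
  finally show "Poly_Mapping.lookup (f \<star> g \<star> h) K = Poly_Mapping.lookup (f \<star> (g \<star> h)) K" .
qed

lemma w0_tilde_squared: "w0_tilde n \<star> w0_tilde n = (lc_of (one_face n) :: _ \<Rightarrow>\<^sub>0 'k::field_char_0)"
proof (rule poly_mapping_eqI)
  fix K
  have "Poly_Mapping.lookup (w0_tilde n \<star> w0_tilde n) K = (\<Sum>F\<in>faces n. \<Sum>G\<in>faces n.
      face_sign n F * face_sign n G * of_bool (face_prod F G = K) :: 'k)"
    unfolding lookup_face_mult[OF w0_tilde_in_face_algebra w0_tilde_in_face_algebra]
    by (intro sum.cong refl) (simp add: lookup_w0_tilde)
  also have "\<dots> = of_bool (K = one_face n)"
  proof (cases "K \<in> faces n")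
    case True
    then show ?thesis by (rule sum_face_sign_face_prod)
  next
    case False
    then have "of_bool (face_prod F G = K) = (0::'k)" if "F \<in> faces n" "G \<in> faces n" for F G
      using that face_prod_in_faces by auto
    moreover have "K \<noteq> one_face n" using False one_face_in_faces by auto
    ultimately show ?thesis by simp
  qed
  finally show "Poly_Mapping.lookup (w0_tilde n \<star> w0_tilde n) K =
      Poly_Mapping.lookup (lc_of (one_face n) :: _ \<Rightarrow>\<^sub>0 'k) K"
    by (auto simp: lookup_single when_def)
qed

lemma face_mult_one_face:
  assumes "f \<in> face_algebra n"
  shows "f \<star> lc_of (one_face n) = f"
proof (rule poly_mapping_eqI)
  fix K
  have one: "lc_of (one_face n) \<in> face_algebra n"
    using one_face_in_faces by (auto simp: face_algebra_def)
  have "Poly_Mapping.lookup (f \<star> lc_of (one_face n)) K =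
      (\<Sum>F\<in>faces n. if F = K then Poly_Mapping.lookup f F else 0)"
    unfolding lookup_face_mult[OF assms one]
  proof (intro sum.cong refl)
    fix F assume F: "F \<in> faces n"
    have "(\<Sum>G\<in>faces n. Poly_Mapping.lookup f F * Poly_Mapping.lookup (lc_of (one_face n)) G *
        of_bool (face_prod F G = K)) =
      (\<Sum>G\<in>faces n. if G = one_face n then
        Poly_Mapping.lookup f F * of_bool (face_prod F G = K) else 0)"
      by (intro sum.cong refl) (auto simp: lookup_single)
    then show "(\<Sum>G\<in>faces n. Poly_Mapping.lookup f F * Poly_Mapping.lookup (lc_of (one_face n)) G *
        of_bool (face_prod F G = K)) = (if F = K then Poly_Mapping.lookup f F else 0)"
      using F by (simp add: one_face_in_faces face_prod_one_face)
  qed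
  then show "Poly_Mapping.lookup (f \<star> lc_of (one_face n)) K = Poly_Mapping.lookup f K"
    using face_algebra_lookup_0[OF assms, of K] by auto
qed

lemma face_mult_w0_tilde_twice:
  fixes f :: "_ \<Rightarrow>\<^sub>0 'k::field_char_0"
  assumes "f \<in> face_algebra n"
  shows "f \<star> w0_tilde n \<star> w0_tilde n = f"
  using assms by (simp add: face_mult_assoc w0_tilde_in_face_algebra w0_tilde_squared face_mult_one_face)

text \<open>K is a product F G with F in the support of f. The refinement serves the knapsack
  filtration, the comparison of lengths serves triangularity.\<close>

lemma keys_face_mult:
  assumes "f \<in> face_algebra n" "g \<in> face_algebra n" "K \<in> Poly_Mapping.keys (f \<star> g)"
  obtains F where "F \<in> Poly_Mapping.keys f" "refines K F" "F = K \<or> length F < length K"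
proof -
  have "\<exists>F\<in>faces n. \<exists>G\<in>faces n. Poly_Mapping.lookup f F * Poly_Mapping.lookup g G *
      of_bool (face_prod F G = K) \<noteq> 0"
  proof (rule ccontr)
    assume "\<not> ?thesis"
    then have "Poly_Mapping.lookup (f \<star> g) K = 0"
      unfolding lookup_face_mult[OF assms(1,2)] by (intro sum.neutral ballI) blast
    with assms(3) show False by (simp add: in_keys_iff)
  qed
  then obtain F G where FG: "F \<in> faces n" "G \<in> faces n" "F \<in> Poly_Mapping.keys f"
      "face_prod F G = K"
    by (auto simp: in_keys_iff split: if_splits)
  have "F = K \<or> length F < length K"
    using FG face_prod_eq_left_iff[OF FG(1,2)] length_face_prod_if_not_refines[OF FG(1,2)] by auto
  with FG that show thesis using refines_face_prod_left by blast
qed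

text \<open>For a face F this is the coefficient of F in the product of F and g, since F G = F means
  that F refines G. It is the one-dimensional character of the face monoid attached to F, extended
  linearly.\<close>

definition face_char :: "nat \<Rightarrow> nat set list \<Rightarrow> (nat set list \<Rightarrow>\<^sub>0 'k::field) \<Rightarrow> 'k" where
  "face_char n F g = (\<Sum>G\<in>faces n. Poly_Mapping.lookup g G * of_bool (refines F G))"

lemma face_char_w0_tilde:
  "F \<in> faces n \<Longrightarrow> face_char n F (w0_tilde n) = (face_sign n F :: 'k::field_char_0)"
  unfolding face_char_def using sum_face_sign_refines[of F n, where 'a = 'k]
  by (simp add: lookup_w0_tilde cong: sum.cong)

lemma face_char_B_tilde:
  "face_char n F (B_tilde n \<alpha>) = (of_nat (knapsack n \<alpha> F) :: 'k::field)"
proof -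
  have "face_char n F (B_tilde n \<alpha> :: _ \<Rightarrow>\<^sub>0 'k) =
      (\<Sum>G\<in>faces n. of_bool (refines F G \<and> face_type G = \<alpha>))"
    unfolding face_char_def by (intro sum.cong refl) (auto simp: lookup_B_tilde)
  also have "\<dots> = of_nat (card (faces n \<inter> {G. refines F G \<and> face_type G = \<alpha>}))"
    by simp
  also have "faces n \<inter> {G. refines F G \<and> face_type G = \<alpha>} =
      {G \<in> faces n. refines F G \<and> face_type G = \<alpha>}"
    by blast
  finally show ?thesis by (simp only: knapsack_def)
qed

text \<open>If no pair with a proper product lands on K, only pairs with F G = F = K contribute. The
  exclusion is later supplied either by the number of blocks or by knapsack numbers.\<close>

lemma lookup_face_mult_char:
  assumes f: "f \<in> face_algebra n" and g: "g \<in> face_algebra n" and K: "K \<in> faces n"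
    and no: "\<And>F G. F \<in> Poly_Mapping.keys f \<Longrightarrow> G \<in> Poly_Mapping.keys g \<Longrightarrow>
      \<not> refines F G \<Longrightarrow> face_prod F G \<noteq> K"
  shows "Poly_Mapping.lookup (f \<star> g) K = Poly_Mapping.lookup f K * face_char n K g"
proof -
  have "Poly_Mapping.lookup (f \<star> g) K = (\<Sum>F\<in>faces n. if F = K then
      Poly_Mapping.lookup f F * face_char n F g else 0)"
    unfolding lookup_face_mult[OF f g]
  proof (intro sum.cong refl)
    fix F assume F: "F \<in> faces n"
    have "Poly_Mapping.lookup f F * Poly_Mapping.lookup g G * of_bool (face_prod F G = K) =
        (if F = K then Poly_Mapping.lookup f F * (Poly_Mapping.lookup g G * of_bool (refines F G))
         else 0)" if G: "G \<in> faces n" for G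
    proof (cases "Poly_Mapping.lookup f F = 0 \<or> Poly_Mapping.lookup g G = 0")
      case False
      then have "\<not> refines F G \<Longrightarrow> face_prod F G \<noteq> K"
        using no by (simp add: in_keys_iff)
      then have "face_prod F G = K \<longleftrightarrow> F = K \<and> refines F G"
        using face_prod_eq_left_iff[OF F G] by auto
      then show ?thesis by simp
    qed auto
    then have "(\<Sum>G\<in>faces n. Poly_Mapping.lookup f F * Poly_Mapping.lookup g G *
        of_bool (face_prod F G = K)) = (\<Sum>G\<in>faces n. if F = K then
          Poly_Mapping.lookup f F * (Poly_Mapping.lookup g G * of_bool (refines F G)) else 0)"
      by (rule sum.cong[OF refl])
    then show "(\<Sum>G\<in>faces n. Poly_Mapping.lookup f F * Poly_Mapping.lookup g G *
        of_bool (face_prod F G = K)) =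
      (if F = K then Poly_Mapping.lookup f F * face_char n F g else 0)"
      by (cases "F = K")
        (simp_all only: face_char_def sum_distrib_left simp_thms if_True if_False sum.neutral_const)
  qed
  then show ?thesis using K by simp
qed

text \<open>A proper product has more blocks than its left factor, hence more than K.\<close>

lemma lookup_face_mult_minimal:
  assumes "f \<in> face_algebra n" "g \<in> face_algebra n" "K \<in> faces n"
    and "\<And>F. F \<in> Poly_Mapping.keys f \<Longrightarrow> F = K \<or> length K \<le> length F"
  shows "Poly_Mapping.lookup (f \<star> g) K = Poly_Mapping.lookup f K * face_char n K g"
proof (rule lookup_face_mult_char[OF assms(1-3)])
  fix F G assume FG: "F \<in> Poly_Mapping.keys f" "G \<in> Poly_Mapping.keys g" "\<not> refines F G"
  then have "F \<in> faces n" "G \<in> faces n"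
    using assms(1,2) by (auto simp: face_algebra_def)
  then have "length F < length (face_prod F G)"
    using FG(3) length_face_prod_if_not_refines by blast
  then show "face_prod F G \<noteq> K"
    using assms(4)[OF FG(1)] by auto
qed

section \<open>Decomposition into eigenvectors\<close>

text \<open>Components may be zero, so C is merely a set of candidate eigenvalues. Keeping the
  components in U allows control of their supports.\<close>

definition eigen_decomp ::
  "('a \<Rightarrow>\<^sub>0 'k::field) set \<Rightarrow> (('a \<Rightarrow>\<^sub>0 'k) \<Rightarrow> ('a \<Rightarrow>\<^sub>0 'k)) \<Rightarrow> 'k set \<Rightarrow> ('a \<Rightarrow>\<^sub>0 'k) \<Rightarrow> bool" where
  "eigen_decomp U T C v \<longleftrightarrow>
    (\<exists>u. (\<forall>c\<in>C. u c \<in> U \<and> T (u c) = lc_scale c (u c)) \<and> v = (\<Sum>c\<in>C. u c))"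

text \<open>Dividing the component for c by c - a gives s with (T - a) s = (T - a) v, so v - s
  satisfies the eigenvector equation for a. This removes one linear factor, and needs a to be
  new.\<close>

lemma eigen_decomp_insert:
  assumes T: "Vector_Spaces.linear lc_scale lc_scale T" and U: "lc.subspace U"
    and C: "finite C" "a \<notin> C" and v: "v \<in> U"
    and dec: "eigen_decomp U T C (T v - lc_scale a v)"
  shows "eigen_decomp U T (insert a C) v"
proof -
  interpret T: Vector_Spaces.linear lc_scale lc_scale T by fact
  obtain u where u: "\<And>c. c \<in> C \<Longrightarrow> u c \<in> U" "\<And>c. c \<in> C \<Longrightarrow> T (u c) = lc_scale c (u c)"
      and sum: "T v - lc_scale a v = (\<Sum>c\<in>C. u c)"
    using dec by (auto simp: eigen_decomp_def)
  define s where "s = (\<lambda>c. lc_scale (1 / (c - a)) (u c))"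
  define u' where "u' = (\<lambda>c. if c = a then v - (\<Sum>c\<in>C. s c) else s c)"
  have s: "s c \<in> U" "T (s c) = lc_scale c (s c)" if "c \<in> C" for c
    using that u U by (simp_all add: s_def lc.subspace_scale T.scale lc.scale_left_commute)
  have "T (\<Sum>c\<in>C. s c) - lc_scale a (\<Sum>c\<in>C. s c) = (\<Sum>c\<in>C. lc_scale (c - a) (s c))"
    by (simp add: T.sum s lc.scale_sum_right lc.scale_left_diff_distrib sum_subtractf)
  also have "\<dots> = (\<Sum>c\<in>C. u c)"
    using C by (intro sum.cong refl) (auto simp: s_def)
  finally have "T (u' a) = lc_scale a (u' a)"
    using sum by (simp add: u'_def T.diff lc.scale_right_diff_distrib) (simp add: algebra_simps)
  moreover have "u' a \<in> U"
    unfolding u'_def using v U s by (simp add: lc.subspace_diff lc.subspace_sum)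
  moreover have "u' c = s c" if "c \<in> C" for c
    using that C by (auto simp: u'_def)
  moreover from this have "v = (\<Sum>c\<in>insert a C. u' c)"
    using C by (simp add: u'_def)
  ultimately show ?thesis
    unfolding eigen_decomp_def using s by (intro exI[of _ u']) auto
qed

lemma eigen_decomp_zero:
  assumes "Vector_Spaces.linear lc_scale lc_scale T" "lc.subspace U"
  shows "eigen_decomp U T C 0"
proof -
  interpret T: Vector_Spaces.linear lc_scale lc_scale T by fact
  show ?thesis
    unfolding eigen_decomp_def using lc.subspace_0[OF assms(2)]
    by (intro exI[of _ "\<lambda>_. 0"]) simp
qed

section \<open>The knapsack filtration\<close>

definition knapsack_ge :: "nat \<Rightarrow> nat list \<Rightarrow> nat \<Rightarrow> (nat set list \<Rightarrow>\<^sub>0 'k::field) set" where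
  "knapsack_ge n \<alpha> m = {f \<in> face_algebra n. \<forall>F\<in>Poly_Mapping.keys f. m \<le> knapsack n \<alpha> F}"

lemma knapsack_ge_0: "knapsack_ge n \<alpha> 0 = face_algebra n"
  by (simp add: knapsack_ge_def)

lemma subspace_knapsack_ge: "lc.subspace (knapsack_ge n \<alpha> m)"
proof (rule lc.subspaceI)
  fix x y :: "nat set list \<Rightarrow>\<^sub>0 'a"
  assume "x \<in> knapsack_ge n \<alpha> m" "y \<in> knapsack_ge n \<alpha> m"
  then show "x + y \<in> knapsack_ge n \<alpha> m"
    using Poly_Mapping.keys_add[of x y] lc.subspace_add[OF subspace_face_algebra[of n], of x y]
    by (auto simp: knapsack_ge_def)
qed (auto simp: knapsack_ge_def face_algebra_def in_keys_iff)

lemma knapsack_le: "knapsack n \<alpha> F \<le> card (faces n)"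
  unfolding knapsack_def by (rule card_mono) auto

text \<open>Knapsack numbers are bounded by the number of faces, so the filtration ends.\<close>

lemma knapsack_ge_trivial: "f \<in> knapsack_ge n \<alpha> (Suc (card (faces n))) \<Longrightarrow> f = 0"
  using knapsack_le[of n \<alpha>] not_less_eq_eq by (auto simp: knapsack_ge_def simp flip: keys_eq_empty)

text \<open>Faces in the support of the product refine faces in the support of f, and refining does
  not lower the knapsack number.\<close>

lemma face_mult_in_knapsack_ge:
  assumes "f \<in> knapsack_ge n \<alpha> m" "g \<in> face_algebra n"
  shows "f \<star> g \<in> knapsack_ge n \<alpha> m"
proof -
  have f: "f \<in> face_algebra n" using assms(1) by (simp add: knapsack_ge_def)
  have "m \<le> knapsack n \<alpha> K" if K: "K \<in> Poly_Mapping.keys (f \<star> g)" for K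
  proof -
    obtain F where F: "F \<in> Poly_Mapping.keys f" "refines K F"
      using K by (rule keys_face_mult[OF f assms(2)])
    then have "m \<le> knapsack n \<alpha> F" using assms(1) by (simp add: knapsack_ge_def)
    also have "\<dots> \<le> knapsack n \<alpha> K" using F(2) by (rule knapsack_mono)
    finally show ?thesis .
  qed
  then show ?thesis
    using face_mult_in_face_algebra[OF f assms(2)] by (simp add: knapsack_ge_def)
qed

text \<open>A proper product with a face of type \<alpha> has knapsack number above m. Faces with
  number at most m are therefore reached only from themselves, with factor their knapsack
  number.\<close>

lemma face_mult_B_tilde_knapsack_ge:
  assumes "f \<in> knapsack_ge n \<alpha> m"
  shows "f \<star> B_tilde n \<alpha> - lc_scale (of_nat m) f \<in> knapsack_ge n \<alpha> (Suc m)"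
proof -
  have f: "f \<in> face_algebra n" using assms by (simp add: knapsack_ge_def)
  let ?h = "f \<star> B_tilde n \<alpha> - lc_scale (of_nat m) f"
  have h: "?h \<in> face_algebra n"
    by (intro lc.subspace_diff lc.subspace_scale subspace_face_algebra face_mult_in_face_algebra
        B_tilde_in_face_algebra f)
  have "Suc m \<le> knapsack n \<alpha> K" if K: "K \<in> Poly_Mapping.keys ?h" for K
  proof (rule ccontr)
    assume *: "\<not> Suc m \<le> knapsack n \<alpha> K"
    have "K \<in> faces n" using K h by (auto simp: face_algebra_def)
    have "Poly_Mapping.lookup (f \<star> B_tilde n \<alpha>) K =
        Poly_Mapping.lookup f K * face_char n K (B_tilde n \<alpha>)"
    proof (rule lookup_face_mult_char[OF f B_tilde_in_face_algebra \<open>K \<in> faces n\<close>])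
      fix F G :: "nat set list"
      assume FG: "F \<in> Poly_Mapping.keys f"
        "G \<in> Poly_Mapping.keys (B_tilde n \<alpha> :: _ \<Rightarrow>\<^sub>0 'a)" "\<not> refines F G"
      then have "G \<in> faces n" "face_type G = \<alpha>"
        by (auto simp: in_keys_iff lookup_B_tilde split: if_splits)
      then have "knapsack n \<alpha> F < knapsack n \<alpha> (face_prod F G)"
        using FG(3) by (rule knapsack_face_prod_less)
      moreover have "m \<le> knapsack n \<alpha> F"
        using assms FG(1) by (simp add: knapsack_ge_def)
      ultimately show "face_prod F G \<noteq> K" using * by auto
    qed
    \<comment> \<open>On the support of f the knapsack number of K is squeezed to m; off the support
      both sides vanish.\<close>
    also have "\<dots> = of_nat m * Poly_Mapping.lookup f K"
    proof (cases "K \<in> Poly_Mapping.keys f")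
      case True
      then have "m \<le> knapsack n \<alpha> K" using assms by (simp add: knapsack_ge_def)
      with * have "knapsack n \<alpha> K = m" by simp
      then show ?thesis by (simp add: face_char_B_tilde)
    qed (simp add: in_keys_iff)
    finally show False using K by (simp add: in_keys_iff lookup_minus)
  qed
  with h show ?thesis by (simp add: knapsack_ge_def)
qed

definition signed_op ::
  "nat \<Rightarrow> nat list \<Rightarrow> (nat set list \<Rightarrow>\<^sub>0 'k::field) \<Rightarrow> (nat set list \<Rightarrow>\<^sub>0 'k)" where
  "signed_op n \<alpha> f = f \<star> w0_tilde n \<star> B_tilde n \<alpha>"

lemma linear_signed_op: "Vector_Spaces.linear lc_scale lc_scale (signed_op n \<alpha>)"
  by unfold_locales (simp_all add: signed_op_def face_mult_add_left face_mult_scale_left)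

lemma signed_op_in_knapsack_ge:
  "f \<in> knapsack_ge n \<alpha> m \<Longrightarrow> signed_op n \<alpha> f \<in> knapsack_ge n \<alpha> m"
  unfolding signed_op_def
  by (intro face_mult_in_knapsack_ge w0_tilde_in_face_algebra B_tilde_in_face_algebra)

text \<open>On the quotient of two consecutive steps of the filtration, right multiplication by
  \<open>B_tilde n \<alpha>\<close> is the scalar \<open>m\<close> and right multiplication by \<open>w0_tilde n\<close> is an involution.\<close>

lemma signed_op_twice:
  fixes f :: "nat set list \<Rightarrow>\<^sub>0 'k::field_char_0"
  assumes f: "f \<in> knapsack_ge n \<alpha> m"
  shows "signed_op n \<alpha> (signed_op n \<alpha> f) - lc_scale (of_nat m * of_nat m) f
    \<in> knapsack_ge n \<alpha> (Suc m)"
proof -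
  let ?T = "signed_op n \<alpha> :: (_ \<Rightarrow>\<^sub>0 'k) \<Rightarrow> _" and ?W = "knapsack_ge n \<alpha> (Suc m) :: (_ \<Rightarrow>\<^sub>0 'k) set"
  interpret T: Vector_Spaces.linear lc_scale lc_scale ?T by (rule linear_signed_op)
  define e where "e = ?T f - lc_scale (of_nat m) (f \<star> w0_tilde n)"
  define e' where "e' = f \<star> B_tilde n \<alpha> - lc_scale (of_nat m) f"
  have e: "e \<in> ?W"
    unfolding e_def signed_op_def
    by (intro face_mult_B_tilde_knapsack_ge face_mult_in_knapsack_ge f w0_tilde_in_face_algebra)
  have e': "e' \<in> ?W"
    unfolding e'_def by (rule face_mult_B_tilde_knapsack_ge[OF f])
  have "f \<in> face_algebra n" using f by (simp add: knapsack_ge_def)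
  \<comment> \<open>The outer operator multiplies by \<open>w0_tilde n\<close> first, which cancels
    the factor left by the inner one.\<close>
  then have P: "?T (f \<star> w0_tilde n) = f \<star> B_tilde n \<alpha>"
    by (simp add: signed_op_def face_mult_w0_tilde_twice)
  have "?T f = lc_scale (of_nat m) (f \<star> w0_tilde n) + e"
    by (simp add: e_def)
  then have "?T (?T f) = lc_scale (of_nat m) (f \<star> B_tilde n \<alpha>) + ?T e"
    by (simp add: T.add T.scale P)
  moreover have "f \<star> B_tilde n \<alpha> = lc_scale (of_nat m) f + e'"
    by (simp add: e'_def)
  ultimately have "?T (?T f) - lc_scale (of_nat m * of_nat m) f = lc_scale (of_nat m) e' + ?T e"
    by (simp add: lc.scale_right_distrib)
  moreover have "lc_scale (of_nat m) e' + ?T e \<in> ?W"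
    by (intro lc.subspace_add lc.subspace_scale subspace_knapsack_ge signed_op_in_knapsack_ge e e')
  ultimately show ?thesis by simp
qed

text \<open>The factors are removed one at a time by \<open>eigen_decomp_insert\<close>. Only T and
  linear combinations are applied to v, so everything stays in any invariant subspace U.\<close>

lemma signed_op_eigen_decomp:
  fixes U :: "(nat set list \<Rightarrow>\<^sub>0 'k::field_char_0) set"
  assumes U: "lc.subspace U" and inv: "\<And>v. v \<in> U \<Longrightarrow> signed_op n \<alpha> v \<in> U"
    and v: "v \<in> U" "v \<in> face_algebra n"
  obtains C where "finite C" "eigen_decomp U (signed_op n \<alpha>) C v"
proof -
  let ?T = "signed_op n \<alpha> :: (_ \<Rightarrow>\<^sub>0 'k) \<Rightarrow> _"
  let ?M = "card (faces n)"
  interpret T: Vector_Spaces.linear lc_scale lc_scale ?T by (rule linear_signed_op)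
  \<comment> \<open>Candidate eigenvalues for the filtration from step m on: both signs of every
    integer between m and the largest possible knapsack number.\<close>
  define C where "C = (\<lambda>m::nat. (of_int :: int \<Rightarrow> 'k) ` {k. int m \<le> \<bar>k\<bar> \<and> \<bar>k\<bar> \<le> int ?M})"
  have "{k. int m \<le> \<bar>k\<bar> \<and> \<bar>k\<bar> \<le> int ?M} \<subseteq> {- int ?M..int ?M}" for m
    by auto
  then have fin: "finite (C m)" for m
    unfolding C_def using finite_subset by blast
  \<comment> \<open>Induction on the number of steps left, each contributing the pair c, -c with c =
    m + 1; positivity of c keeps the two apart.\<close>
  have pos: "eigen_decomp U ?T (C (Suc m)) v"
    if "m \<le> ?M" "v \<in> U" "v \<in> knapsack_ge n \<alpha> (Suc m)" for m v
    using that
  proof (induction "?M - m" arbitrary: m v)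
    case 0
    then have "v = 0" by (intro knapsack_ge_trivial[of _ n \<alpha>]) simp
    then show ?case using eigen_decomp_zero[OF linear_signed_op U] by simp
  next
    case (Suc d)
    define c where "c = (of_nat (Suc m) :: 'k)"
    have c: "c = of_int (int (Suc m))" "- c = of_int (- int (Suc m))"
      by (simp_all add: c_def)
    have ins: "C (Suc m) = insert c (insert (- c) (C (Suc (Suc m))))"
    proof -
      have "{k. int (Suc m) \<le> \<bar>k\<bar> \<and> \<bar>k\<bar> \<le> int ?M} =
        insert (int (Suc m)) (insert (- int (Suc m)) {k. int (Suc (Suc m)) \<le> \<bar>k\<bar> \<and> \<bar>k\<bar> \<le> int ?M})"
        using Suc.hyps(2) by auto
      then show ?thesis unfolding C_def c by simp
    qed
    have notin: "- c \<notin> C (Suc (Suc m))" "c \<notin> insert (- c) (C (Suc (Suc m)))"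
    proof -
      have inj: "inj (of_int :: int \<Rightarrow> 'k)" by (simp add: inj_def)
      show "- c \<notin> C (Suc (Suc m))"
        unfolding C_def c(2) inj_image_mem_iff[OF inj] by simp
      have "c \<notin> C (Suc (Suc m))"
        unfolding C_def c(1) inj_image_mem_iff[OF inj] by simp
      moreover have "c \<noteq> - c"
        unfolding c(2) unfolding c(1) of_int_eq_iff by simp
      ultimately show "c \<notin> insert (- c) (C (Suc (Suc m)))" by simp
    qed
    \<comment> \<open>The square splits as (T + c)(T - c): the induction hypothesis covers (T + c)
      w, then -c is added to reach w and c to reach v.\<close>
    define w where "w = ?T v - lc_scale c v"
    have w: "w \<in> U"
      unfolding w_def by (intro lc.subspace_diff lc.subspace_scale U inv Suc.prems)
    have "?T w - lc_scale (- c) w = ?T (?T v) - lc_scale (c * c) v"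
      by (simp add: w_def T.diff T.scale lc.scale_right_diff_distrib)
    moreover have "\<dots> \<in> knapsack_ge n \<alpha> (Suc (Suc m))"
      unfolding c_def by (rule signed_op_twice[OF Suc.prems(3)])
    moreover have "?T w - lc_scale (- c) w \<in> U"
      by (intro lc.subspace_diff lc.subspace_scale U inv w)
    ultimately have "eigen_decomp U ?T (C (Suc (Suc m))) (?T w - lc_scale (- c) w)"
      using Suc.hyps(2) by (intro Suc.hyps(1)) auto
    then have "eigen_decomp U ?T (insert (- c) (C (Suc (Suc m)))) w"
      by (intro eigen_decomp_insert linear_signed_op U fin notin w)
    then show ?case
      unfolding ins w_def
      by (rule eigen_decomp_insert[OF linear_signed_op U _ notin(2) Suc.prems(2), rotated])
        (simp add: fin)
  qed
  \<comment> \<open>The bottom layer: as \<open>B_tilde n \<alpha>\<close> acts there by 0, one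
    application of T enters the next step, and 0 is inserted only once.\<close>
  have "?T v - lc_scale 0 v \<in> knapsack_ge n \<alpha> (Suc 0)"
    using face_mult_B_tilde_knapsack_ge[of "v \<star> w0_tilde n" n \<alpha> 0] v(2)
    by (simp add: signed_op_def knapsack_ge_0 face_mult_in_face_algebra w0_tilde_in_face_algebra)
  moreover have "?T v - lc_scale 0 v \<in> U"
    using inv v by simp
  ultimately have "eigen_decomp U ?T (C (Suc 0)) (?T v - lc_scale 0 v)"
    by (intro pos) auto
  moreover have "0 \<notin> C (Suc 0)"
    by (auto simp: C_def)
  ultimately have "eigen_decomp U ?T (insert 0 (C (Suc 0))) v"
    using fin v by (intro eigen_decomp_insert linear_signed_op U)
  with fin that show thesis by blast
qed

section \<open>Characteristic polynomials of operators\<close>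

text \<open>Two different bases are allowed, so that change-of-basis matrices are the case S =
  id.\<close>

definition basis_mat ::
  "('a \<Rightarrow>\<^sub>0 'k::field) list \<Rightarrow> ('a \<Rightarrow>\<^sub>0 'k) list \<Rightarrow> (('a \<Rightarrow>\<^sub>0 'k) \<Rightarrow> ('a \<Rightarrow>\<^sub>0 'k)) \<Rightarrow> 'k mat" where
  "basis_mat bs cs S = mat (length bs) (length cs)
    (\<lambda>(i, j). lc.representation (set bs) (S (cs ! j)) (bs ! i))"

lemma basis_mat_mult:
  assumes S: "Vector_Spaces.linear lc_scale lc_scale S"
    and bs: "lc.independent (set bs)" and cs: "distinct cs" "lc.independent (set cs)"
    and SV: "\<And>v. v \<in> set cs \<Longrightarrow> S v \<in> lc.span (set bs)"
    and SV': "\<And>v. v \<in> set ds \<Longrightarrow> S' v \<in> lc.span (set cs)"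
  shows "basis_mat bs cs S * basis_mat cs ds S' = basis_mat bs ds (S \<circ> S')"
proof (rule eq_matI)
  interpret S: Vector_Spaces.linear lc_scale lc_scale S by fact
  fix i j assume "i < dim_row (basis_mat bs ds (S \<circ> S'))" "j < dim_col (basis_mat bs ds (S \<circ> S'))"
  then have ij: "i < length bs" "j < length ds" by (simp_all add: basis_mat_def)
  let ?R = "lc.representation (set bs)" and ?R' = "lc.representation (set cs)"
  let ?w = "S' (ds ! j)"
  have w: "?w = (\<Sum>c\<in>set cs. lc_scale (?R' ?w c) c)"
    using lc.sum_representation_eq[OF cs(2) SV'[OF nth_mem[OF ij(2)]], of "set cs"] by simp
  have "(basis_mat bs cs S * basis_mat cs ds S') $$ (i, j) =
      (\<Sum>k<length cs. ?R (S (cs ! k)) (bs ! i) * ?R' ?w (cs ! k))"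
    using ij by (simp add: basis_mat_def scalar_prod_def lessThan_atLeast0)
  also have "\<dots> = (\<Sum>c\<in>set cs. ?R (S c) (bs ! i) * ?R' ?w c)"
    by (rule sum.reindex_bij_betw[OF bij_betw_nth[OF cs(1) refl refl],
          of "\<lambda>c. ?R (S c) (bs ! i) * ?R' ?w c"])
  also have "\<dots> = (\<Sum>c\<in>set cs. ?R (lc_scale (?R' ?w c) (S c)) (bs ! i))"
    using SV by (intro sum.cong refl) (simp add: lc.representation_scale[OF bs] mult.commute)
  also have "\<dots> = ?R (\<Sum>c\<in>set cs. lc_scale (?R' ?w c) (S c)) (bs ! i)"
    by (subst lc.representation_sum[OF bs]) (auto intro: lc.span_scale SV)
  also have "(\<Sum>c\<in>set cs. lc_scale (?R' ?w c) (S c)) = S (\<Sum>c\<in>set cs. lc_scale (?R' ?w c) c)"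
    by (simp add: S.sum S.scale)
  also have "\<dots> = S ?w" using w by simp
  finally show "(basis_mat bs cs S * basis_mat cs ds S') $$ (i, j) =
      basis_mat bs ds (S \<circ> S') $$ (i, j)"
    using ij by (simp add: basis_mat_def)
qed (simp_all add: basis_mat_def)

lemma basis_mat_id:
  assumes "distinct bs" "lc.independent (set bs)"
  shows "basis_mat bs bs id = 1\<^sub>m (length bs)"
  using assms by (intro eq_matI)
    (auto simp: basis_mat_def lc.representation_basis nth_eq_iff_index_eq)

text \<open>The basis picked by \<open>SOME\<close> is unknown, but the identity, written in the two
  bases, conjugates one matrix of T into the other.\<close>

lemma char_poly_on_eq:
  fixes V :: "('a \<Rightarrow>\<^sub>0 'k::field) set"
  assumes T: "Vector_Spaces.linear lc_scale lc_scale T" and inv: "\<And>v. v \<in> V \<Longrightarrow> T v \<in> V"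
    and bs: "ordered_basis_of V bs"
  shows "char_poly_on V T = char_poly (matrix_wrt bs T)"
proof -
  define cs where "cs = (SOME bs. ordered_basis_of V bs)"
  have cs: "ordered_basis_of V cs"
    unfolding cs_def using bs by (rule someI)
  have B: "distinct bs" "lc.independent (set bs)" "lc.span (set bs) = V"
    and C: "distinct cs" "lc.independent (set cs)" "lc.span (set cs) = V"
    using bs cs by (auto simp: ordered_basis_of_def)
  have "card (set bs) = lc.dim V" "card (set cs) = lc.dim V"
    using lc.dim_span_eq_card_independent B C by metis+
  then have len: "length bs = length cs"
    using B(1) C(1) by (simp add: distinct_card)
  have sub: "set bs \<subseteq> V" "set cs \<subseteq> V"
    using B(3) C(3) lc.span_superset by blast+
  have id: "Vector_Spaces.linear lc_scale lc_scale (id :: ('a \<Rightarrow>\<^sub>0 'k) \<Rightarrow> _)"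
    by unfold_locales auto
  let ?P = "basis_mat cs bs id" and ?Q = "basis_mat bs cs id"
  have "similar_mat (matrix_wrt cs T) (matrix_wrt bs T)"
  proof (rule similar_matI[where n = "length cs"])
    show "{matrix_wrt cs T, matrix_wrt bs T, ?P, ?Q} \<subseteq> carrier_mat (length cs) (length cs)"
      using len by (auto simp: matrix_wrt_def basis_mat_def)
    show "?P * ?Q = 1\<^sub>m (length cs)"
      using basis_mat_mult[OF id C(2) B(1,2), of cs id] basis_mat_id[OF C(1,2)] B C sub by auto
    show "?Q * ?P = 1\<^sub>m (length cs)"
      using basis_mat_mult[OF id B(2) C(1,2), of bs id] basis_mat_id[OF B(1,2)] B C sub len by auto
    have eq: "matrix_wrt xs T = basis_mat xs xs T" for xs
      by (simp add: matrix_wrt_def basis_mat_def)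
    have "?P * matrix_wrt bs T = basis_mat cs bs T"
      using basis_mat_mult[OF id C(2) B(1,2), of bs T] B C sub inv by (auto simp: eq)
    moreover have "basis_mat cs bs T * ?Q = matrix_wrt cs T"
      using basis_mat_mult[OF T C(2) B(1,2), of cs id] B C sub inv by (auto simp: eq)
    ultimately show "matrix_wrt cs T = ?P * matrix_wrt bs T * ?Q" by simp
  qed
  then show ?thesis
    unfolding char_poly_on_def cs_def[symmetric] by (rule char_poly_similar)
qed

lemma order_prod_list_linear:
  "Polynomial.order c (\<Prod>a\<leftarrow>xs. [:- a, 1:]) = length (filter (\<lambda>a. a = c) (xs :: 'k::field list))"
proof (induction xs)
  case (Cons a xs)
  have "Polynomial.order c [:- a, 1:] = of_bool (a = c)"
    using order_power_n_n[of c 1] by (auto intro: order_0I)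
  moreover have "(\<Prod>a\<leftarrow>xs. [:- a, 1:]) \<noteq> 0"
    by (auto simp: prod_list_zero_iff)
  then have prod: "[:- a, 1:] * (\<Prod>a\<leftarrow>xs. [:- a, 1:]) \<noteq> 0"
    unfolding mult_eq_0_iff by simp
  ultimately show ?case
    using Cons order_mult[OF prod] by (simp del: mult_pCons_left)
qed simp

section \<open>The spectrum\<close>

lemma lc_of_in_face_algebra: "F \<in> faces n \<Longrightarrow> lc_of F \<in> face_algebra n"
  by (auto simp: face_algebra_def)

lemma signed_op_in_face_algebra: "f \<in> face_algebra n \<Longrightarrow> signed_op n \<alpha> f \<in> face_algebra n"
  unfolding signed_op_def
  by (intro face_mult_in_face_algebra w0_tilde_in_face_algebra B_tilde_in_face_algebra)

lemma keys_signed_op: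
  assumes f: "f \<in> face_algebra n" and K: "K \<in> Poly_Mapping.keys (signed_op n \<alpha> f)"
  obtains F where "F \<in> Poly_Mapping.keys f" "F = K \<or> length F < length K"
proof -
  obtain H where H: "H \<in> Poly_Mapping.keys (f \<star> w0_tilde n)" "H = K \<or> length H < length K"
    using K unfolding signed_op_def
    by (rule keys_face_mult[OF face_mult_in_face_algebra[OF f w0_tilde_in_face_algebra]
          B_tilde_in_face_algebra])
  obtain F where "F \<in> Poly_Mapping.keys f" "F = H \<or> length F < length H"
    using H(1) by (rule keys_face_mult[OF f w0_tilde_in_face_algebra])
  with H(2) that show thesis by fastforce
qed

text \<open>Multiplying by \<open>w0_tilde n\<close> yields no face in the support shorter than K,
  so \<open>lookup_face_mult_minimal\<close> applies twice; the two characters contribute the sign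
  and the knapsack number.\<close>

lemma lookup_signed_op_minimal:
  fixes f :: "nat set list \<Rightarrow>\<^sub>0 'k::field_char_0"
  assumes f: "f \<in> face_algebra n" and K: "K \<in> faces n"
    and min: "\<And>F. F \<in> Poly_Mapping.keys f \<Longrightarrow> F = K \<or> length K \<le> length F"
  shows "Poly_Mapping.lookup (signed_op n \<alpha> f) K =
    of_int (signed_knapsack n \<alpha> K) * Poly_Mapping.lookup f K"
proof -
  have "Poly_Mapping.lookup (signed_op n \<alpha> f) K =
      Poly_Mapping.lookup (f \<star> w0_tilde n) K * face_char n K (B_tilde n \<alpha>)"
    unfolding signed_op_def
  proof (rule lookup_face_mult_minimal)
    fix H assume "H \<in> Poly_Mapping.keys (f \<star> w0_tilde n)"
    then obtain F where "F \<in> Poly_Mapping.keys f" "F = H \<or> length F < length H"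
      by (rule keys_face_mult[OF f w0_tilde_in_face_algebra])
    with min show "H = K \<or> length K \<le> length H" by fastforce
  qed (intro face_mult_in_face_algebra f w0_tilde_in_face_algebra B_tilde_in_face_algebra K)+
  also have "Poly_Mapping.lookup (f \<star> w0_tilde n) K =
      Poly_Mapping.lookup f K * face_char n K (w0_tilde n)"
    by (rule lookup_face_mult_minimal[OF f w0_tilde_in_face_algebra K min])
  finally show ?thesis
    using K by (simp add: face_char_w0_tilde face_char_B_tilde signed_knapsack_def face_sign_def)
qed

text \<open>Compare coefficients of the eigenvector equation at a face of v with the fewest
  blocks.\<close>

lemma eigenvalue_imp_signed_knapsack:
  fixes v :: "nat set list \<Rightarrow>\<^sub>0 'k::field_char_0"
  assumes v: "v \<in> face_algebra n" "v \<noteq> 0" and eig: "signed_op n \<alpha> v = lc_scale c v"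
  shows "\<exists>F\<in>faces n. c = of_int (signed_knapsack n \<alpha> F)"
proof -
  have ne: "Poly_Mapping.keys v \<noteq> {}" using v(2) by simp
  define K where "K = arg_min_on length (Poly_Mapping.keys v)"
  have K: "K \<in> Poly_Mapping.keys v" "\<And>F. F \<in> Poly_Mapping.keys v \<Longrightarrow> length K \<le> length F"
    unfolding K_def using arg_min_if_finite[OF finite_keys ne, of length]
    by (auto simp: not_less intro: arg_min_least)
  have "K \<in> faces n" using K(1) v(1) by (auto simp: face_algebra_def)
  then have "Poly_Mapping.lookup (signed_op n \<alpha> v) K =
      of_int (signed_knapsack n \<alpha> K) * Poly_Mapping.lookup v K"
    using K(2) by (intro lookup_signed_op_minimal v(1)) auto
  with K(1) eig have "c = of_int (signed_knapsack n \<alpha> K)"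
    by (simp add: in_keys_iff)
  with \<open>K \<in> faces n\<close> show ?thesis by blast
qed

text \<open>F and the faces with more blocks span an invariant subspace. When F is decomposed there
  into eigenvectors, some component has a nonzero coefficient at F, and comparing coefficients at F
  identifies its eigenvalue.\<close>

lemma signed_knapsack_imp_eigenvalue:
  assumes F: "F \<in> faces n"
  shows "eigenvalue_on (face_algebra n) (signed_op n \<alpha>)
    (of_int (signed_knapsack n \<alpha> F) :: 'k::field_char_0)"
proof -
  let ?T = "signed_op n \<alpha> :: (_ \<Rightarrow>\<^sub>0 'k) \<Rightarrow> _"
  define U :: "(nat set list \<Rightarrow>\<^sub>0 'k) set" where
    "U = {f \<in> face_algebra n. \<forall>K\<in>Poly_Mapping.keys f. K = F \<or> length F < length K}"
  have U: "lc.subspace U"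
  proof (rule lc.subspaceI)
    fix x y :: "nat set list \<Rightarrow>\<^sub>0 'k"
    assume "x \<in> U" "y \<in> U"
    then show "x + y \<in> U"
      using Poly_Mapping.keys_add[of x y] lc.subspace_add[OF subspace_face_algebra[of n], of x y]
      by (auto simp: U_def)
  qed (auto simp: U_def face_algebra_def in_keys_iff)
  have inv: "?T v \<in> U" if "v \<in> U" for v
  proof -
    have v: "v \<in> face_algebra n" using that by (simp add: U_def)
    have "K = F \<or> length F < length K" if K: "K \<in> Poly_Mapping.keys (?T v)" for K
    proof -
      obtain H where "H \<in> Poly_Mapping.keys v" "H = K \<or> length H < length K"
        using K by (rule keys_signed_op[OF v])
      with \<open>v \<in> U\<close> show ?thesis by (fastforce simp: U_def)
    qed
    with signed_op_in_face_algebra[OF v] show ?thesis by (simp add: U_def)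
  qed
  have lc: "(lc_of F :: _ \<Rightarrow>\<^sub>0 'k) \<in> face_algebra n"
    using F by (rule lc_of_in_face_algebra)
  then have "(lc_of F :: _ \<Rightarrow>\<^sub>0 'k) \<in> U" by (simp add: U_def)
  then obtain C where C: "finite C" "eigen_decomp U ?T C (lc_of F)"
    using signed_op_eigen_decomp[OF U inv _ lc] by blast
  then obtain u where u: "\<And>c. c \<in> C \<Longrightarrow> u c \<in> U" "\<And>c. c \<in> C \<Longrightarrow> ?T (u c) = lc_scale c (u c)"
      and sum: "lc_of F = (\<Sum>c\<in>C. u c)"
    by (auto simp: eigen_decomp_def)
  have "(\<Sum>c\<in>C. Poly_Mapping.lookup (u c) F) = 1"
    by (simp flip: lookup_sum sum)
  then obtain c where c: "c \<in> C" "Poly_Mapping.lookup (u c) F \<noteq> 0"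
    by (metis sum.neutral zero_neq_one)
  have uc: "u c \<in> face_algebra n" using u(1)[OF c(1)] by (simp add: U_def)
  have "Poly_Mapping.lookup (?T (u c)) F =
      of_int (signed_knapsack n \<alpha> F) * Poly_Mapping.lookup (u c) F"
    using u(1)[OF c(1)] by (intro lookup_signed_op_minimal uc F) (auto simp: U_def)
  with u(2)[OF c(1)] c(2) have "c = of_int (signed_knapsack n \<alpha> F)" by simp
  moreover have "u c \<noteq> 0" using c(2) by auto
  ultimately show ?thesis
    unfolding eigenvalue_on_def using uc u(2)[OF c(1)] by blast
qed

text \<open>A maximal independent set of eigenvectors spans, since every vector is a sum of
  eigenvectors.\<close>

lemma diagonalizable_signed_op:
  "diagonalizable_on (face_algebra n)
    (signed_op n \<alpha> :: (_ \<Rightarrow>\<^sub>0 'k::field_char_0) \<Rightarrow> _)"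
proof -
  let ?T = "signed_op n \<alpha> :: (_ \<Rightarrow>\<^sub>0 'k) \<Rightarrow> _"
  define S where "S = {v \<in> face_algebra n. \<exists>c. ?T v = lc_scale c v}"
  obtain E where E: "E \<subseteq> S" "lc.independent E" "S \<subseteq> lc.span E"
    using lc.maximal_independent_subset by blast
  have "lc.span E \<subseteq> face_algebra n"
    using E(1) by (intro lc.span_minimal subspace_face_algebra) (auto simp: S_def)
  moreover have "v \<in> lc.span E" if v: "v \<in> face_algebra n" for v
  proof -
    obtain C where "finite C" "eigen_decomp (face_algebra n) ?T C v"
      using signed_op_eigen_decomp[OF subspace_face_algebra signed_op_in_face_algebra v v] .
    then obtain u where "\<And>c. c \<in> C \<Longrightarrow> u c \<in> S" "v = (\<Sum>c\<in>C. u c)"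
      by (auto simp: eigen_decomp_def S_def)
    then show ?thesis using E(3) by (auto intro!: lc.span_sum)
  qed
  ultimately have "lc.span E = face_algebra n" by blast
  with E show ?thesis unfolding diagonalizable_on_def S_def by blast
qed

lemma independent_lc_of: "finite A \<Longrightarrow> lc.independent (lc_of ` A :: ('a \<Rightarrow>\<^sub>0 'k::field) set)"
proof (rule lc.independent_if_scalars_zero)
  fix f and x :: "'a \<Rightarrow>\<^sub>0 'k"
  assume A: "finite A" and sum: "(\<Sum>x\<in>lc_of ` A. lc_scale (f x) x) = (0 :: 'a \<Rightarrow>\<^sub>0 'k)"
    and x: "x \<in> lc_of ` A"
  then obtain a where a: "a \<in> A" "x = lc_of a" by blast
  have "inj_on (lc_of :: 'a \<Rightarrow> 'a \<Rightarrow>\<^sub>0 'k) A"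
    by (auto simp: inj_on_def dest: arg_cong[where f = Poly_Mapping.keys])
  then have "(\<Sum>b\<in>A. lc_scale (f (lc_of b)) (lc_of b)) = 0"
    using sum by (simp add: sum.reindex)
  then have "(\<Sum>b\<in>A. f (lc_of b) * Poly_Mapping.lookup (lc_of b) a) = 0"
    by (metis (no_types, lifting) lookup_lc_scale lookup_sum lookup_zero sum.cong)
  moreover have "(\<Sum>b\<in>A. f (lc_of b) * Poly_Mapping.lookup (lc_of b) a) =
      (\<Sum>b\<in>A. if b = a then f (lc_of b) else 0)"
    by (intro sum.cong refl) (auto simp: lookup_single)
  ultimately show "f x = 0" using a A by simp
qed simp

lemma face_algebra_expand:
  assumes "f \<in> face_algebra n"
  shows "f = (\<Sum>F\<in>faces n. lc_scale (Poly_Mapping.lookup f F) (lc_of F))"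
proof (rule poly_mapping_eqI)
  fix K
  have "Poly_Mapping.lookup (\<Sum>F\<in>faces n. lc_scale (Poly_Mapping.lookup f F) (lc_of F)) K =
      (\<Sum>F\<in>faces n. if F = K then Poly_Mapping.lookup f F else 0)"
    unfolding lookup_sum by (intro sum.cong refl) (auto simp: lookup_single)
  then show "Poly_Mapping.lookup f K =
      Poly_Mapping.lookup (\<Sum>F\<in>faces n. lc_scale (Poly_Mapping.lookup f F) (lc_of F)) K"
    using face_algebra_lookup_0[OF assms] by simp
qed

lemma span_faces: "lc.span (lc_of ` faces n) = (face_algebra n :: (_ \<Rightarrow>\<^sub>0 'k::field) set)"
proof (rule antisym)
  show "lc.span (lc_of ` faces n) \<subseteq> (face_algebra n :: (_ \<Rightarrow>\<^sub>0 'k) set)"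
    by (intro lc.span_minimal subspace_face_algebra) (auto intro: lc_of_in_face_algebra)
  show "(face_algebra n :: (_ \<Rightarrow>\<^sub>0 'k) set) \<subseteq> lc.span (lc_of ` faces n)"
  proof
    fix f :: "nat set list \<Rightarrow>\<^sub>0 'k" assume "f \<in> face_algebra n"
    then have "f = (\<Sum>F\<in>faces n. lc_scale (Poly_Mapping.lookup f F) (lc_of F))"
      by (rule face_algebra_expand)
    also have "\<dots> \<in> lc.span (lc_of ` faces n)"
      by (intro lc.span_sum lc.span_scale lc.span_base imageI)
    finally show "f \<in> lc.span (lc_of ` faces n)" .
  qed
qed

lemma representation_faces:
  fixes f :: "nat set list \<Rightarrow>\<^sub>0 'k::field"
  assumes f: "f \<in> face_algebra n" and K: "K \<in> faces n"
  shows "lc.representation (lc_of ` faces n) f (lc_of K) = Poly_Mapping.lookup f K"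
proof -
  let ?R = "lc.representation (lc_of ` faces n) :: (_ \<Rightarrow>\<^sub>0 'k) \<Rightarrow> _"
  let ?B = "lc_of ` faces n :: (_ \<Rightarrow>\<^sub>0 'k) set"
  have ind: "lc.independent ?B" by (rule independent_lc_of) simp
  have "?R f = ?R (\<Sum>F\<in>faces n. lc_scale (Poly_Mapping.lookup f F) (lc_of F))"
    using face_algebra_expand[OF f] by simp
  also have "\<dots> = (\<lambda>b. \<Sum>F\<in>faces n. ?R (lc_scale (Poly_Mapping.lookup f F) (lc_of F)) b)"
    by (rule lc.representation_sum[OF ind]) (intro lc.span_scale lc.span_base imageI)
  finally have "?R f (lc_of K) =
      (\<Sum>F\<in>faces n. ?R (lc_scale (Poly_Mapping.lookup f F) (lc_of F)) (lc_of K))"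
    by simp
  also have "\<dots> = (\<Sum>F\<in>faces n. if F = K then Poly_Mapping.lookup f F else 0)"
  proof (intro sum.cong refl)
    fix F assume F: "F \<in> faces n"
    have "(lc_of K :: _ \<Rightarrow>\<^sub>0 'k) = lc_of F \<longleftrightarrow> F = K"
      by (auto dest: arg_cong[where f = Poly_Mapping.keys])
    then show "?R (lc_scale (Poly_Mapping.lookup f F) (lc_of F)) (lc_of K) =
        (if F = K then Poly_Mapping.lookup f F else 0)"
      using F by (simp add: lc.representation_scale[OF ind] lc.span_base
          lc.representation_basis[OF ind])
  qed
  finally show ?thesis using K by simp
qed

text \<open>In a basis of suitably ordered faces the matrix is upper triangular, so the
  characteristic polynomial is read off its diagonal.\<close>

lemma alg_multiplicity_signed_op:
  "alg_multiplicity_on (face_algebra n) (signed_op n \<alpha>) (c :: 'k::field_char_0) =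
    card {F \<in> faces n. of_int (signed_knapsack n \<alpha> F) = c}"
proof -
  let ?T = "signed_op n \<alpha> :: (_ \<Rightarrow>\<^sub>0 'k) \<Rightarrow> _"
  obtain xs where xs: "set xs = faces n" "distinct xs"
    using finite_distinct_list[OF finite_faces] by blast
  \<comment> \<open>Longer faces come first: the image of a face contains only itself and longer
    faces, which puts the nonzero entries on or above the diagonal.\<close>
  define fs where "fs = rev (sort_key length xs)"
  have fs: "set fs = faces n" "distinct fs"
    using xs by (simp_all add: fs_def)
  have dec: "length (fs ! i) \<le> length (fs ! j)" if "j < i" "i < length fs" for i j
  proof -
    have "sorted (map length (sort_key length xs))" by simp
    then show ?thesis
      using that by (auto simp: fs_def rev_nth sorted_iff_nth_mono)
  qed
  define bs where "bs = map (lc_of :: _ \<Rightarrow> _ \<Rightarrow>\<^sub>0 'k) fs"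
  have set_bs: "set bs = lc_of ` faces n" by (simp add: bs_def fs)
  have "inj_on (lc_of :: _ \<Rightarrow> _ \<Rightarrow>\<^sub>0 'k) (set fs)"
    by (auto simp: inj_on_def dest: arg_cong[where f = Poly_Mapping.keys])
  then have basis: "ordered_basis_of (face_algebra n) bs"
    unfolding ordered_basis_of_def set_bs
    using fs(2) by (intro conjI independent_lc_of finite_faces span_faces)
      (simp add: bs_def distinct_map)
  let ?A = "matrix_wrt bs ?T"
  have entry: "?A $$ (i, j) = Poly_Mapping.lookup (?T (lc_of (fs ! j))) (fs ! i)"
    if "i < length fs" "j < length fs" for i j
  proof -
    have "fs ! i \<in> faces n" "fs ! j \<in> faces n" using that fs(1) nth_mem by blast+
    then show ?thesis
      using that unfolding matrix_wrt_def set_bs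
      by (simp add: bs_def representation_faces signed_op_in_face_algebra lc_of_in_face_algebra)
  qed
  have dim: "?A \<in> carrier_mat (length fs) (length fs)"
    by (simp add: matrix_wrt_def bs_def)
  have "upper_triangular ?A"
  proof (rule upper_triangularI)
    fix i j assume ij: "j < i" "i < dim_row ?A"
    then have i: "i < length fs" "j < length fs" using dim by auto
    have F: "fs ! j \<in> faces n" using i fs(1) nth_mem by blast
    have "fs ! i \<notin> Poly_Mapping.keys (?T (lc_of (fs ! j)))"
    proof
      assume "fs ! i \<in> Poly_Mapping.keys (?T (lc_of (fs ! j)))"
      then obtain F' where "F' \<in> Poly_Mapping.keys (lc_of (fs ! j) :: _ \<Rightarrow>\<^sub>0 'k)"
          "F' = fs ! i \<or> length F' < length (fs ! i)"
        by (rule keys_signed_op[OF lc_of_in_face_algebra[OF F]])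
      then have "fs ! j = fs ! i \<or> length (fs ! j) < length (fs ! i)" by simp
      then show False
        using dec[OF ij(1) i(1)] fs(2) i ij(1) by (auto simp: nth_eq_iff_index_eq)
    qed
    then show "?A $$ (i, j) = 0" using entry[OF i] by (simp add: in_keys_iff)
  qed
  then have "char_poly ?A = (\<Prod>a\<leftarrow>diag_mat ?A. [:- a, 1:])"
    by (rule char_poly_upper_triangular[OF dim])
  moreover have "diag_mat ?A = map (\<lambda>F. of_int (signed_knapsack n \<alpha> F)) fs"
  proof (rule nth_equalityI)
    fix i assume "i < length (diag_mat ?A)"
    then have i: "i < length fs" using dim by (simp add: diag_mat_def)
    then have "fs ! i \<in> faces n" using fs(1) nth_mem by blast
    then have "Poly_Mapping.lookup (?T (lc_of (fs ! i))) (fs ! i) =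
        of_int (signed_knapsack n \<alpha> (fs ! i))"
      using lookup_signed_op_minimal[OF lc_of_in_face_algebra, of "fs ! i" n "fs ! i" \<alpha>, where 'k = 'k]
      by simp
    then show "diag_mat ?A ! i = map (\<lambda>F. of_int (signed_knapsack n \<alpha> F)) fs ! i"
      using i dim entry[OF i i] by (simp add: diag_mat_def)
  qed (use dim in \<open>simp add: diag_mat_def\<close>)
  moreover have "char_poly_on (face_algebra n) ?T = char_poly ?A"
    by (rule char_poly_on_eq[OF linear_signed_op _ basis]) (rule signed_op_in_face_algebra)
  ultimately have "alg_multiplicity_on (face_algebra n) ?T c =
      length (filter (\<lambda>a. a = c) (map (\<lambda>F. of_int (signed_knapsack n \<alpha> F)) fs))"
    by (simp only: alg_multiplicity_on_def order_prod_list_linear)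
  also have "\<dots> = length (filter (\<lambda>F. of_int (signed_knapsack n \<alpha> F) = c) fs)"
    by (simp add: filter_map comp_def)
  also have "\<dots> = card (set (filter (\<lambda>F. of_int (signed_knapsack n \<alpha> F) = c) fs))"
    using fs(2) by (intro distinct_card[symmetric]) simp
  also have "set (filter (\<lambda>F. of_int (signed_knapsack n \<alpha> F) = c) fs) =
      {F \<in> faces n. of_int (signed_knapsack n \<alpha> F) = c}"
    using fs(1) by auto
  finally show ?thesis .
qed

theorem theorem8p2:
  fixes n :: nat and \<alpha> :: "nat list"
    and \<rho> :: "((nat \<Rightarrow> nat) \<Rightarrow>\<^sub>0 'k::field_char_0) \<Rightarrow> (nat set list \<Rightarrow>\<^sub>0 'k)"
    and T :: "(nat set list \<Rightarrow>\<^sub>0 'k) \<Rightarrow> (nat set list \<Rightarrow>\<^sub>0 'k)"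
  assumes "\<alpha> \<in> compositions n"
    and "is_rho n \<rho>"
  defines "T \<equiv> \<lambda>f. f \<star> \<rho> (lc_of (w0_perm n)) \<star> B_tilde n \<alpha>"
  shows "diagonalizable_on (face_algebra n) T \<and>
    {c. eigenvalue_on (face_algebra n) T c} =
      (\<lambda>F. of_int (signed_knapsack n \<alpha> F)) ` faces n \<and>
    (\<forall>c. eigenvalue_on (face_algebra n) T c \<longrightarrow>
       alg_multiplicity_on (face_algebra n) T c =
         card {F\<in>faces n. of_int (signed_knapsack n \<alpha> F) = c})"
proof -
  have T: "T = signed_op n \<alpha>"
    by (simp add: T_def fun_eq_iff signed_op_def rho_w0[OF assms(2)])
  have "{c. eigenvalue_on (face_algebra n) T c} =
      (\<lambda>F. of_int (signed_knapsack n \<alpha> F)) ` faces n"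
  proof (intro equalityI subsetI)
    fix c assume "c \<in> {c. eigenvalue_on (face_algebra n) T c}"
    then show "c \<in> (\<lambda>F. of_int (signed_knapsack n \<alpha> F)) ` faces n"
      unfolding T eigenvalue_on_def using eigenvalue_imp_signed_knapsack by blast
  next
    fix c :: 'k assume "c \<in> (\<lambda>F. of_int (signed_knapsack n \<alpha> F)) ` faces n"
    then show "c \<in> {c. eigenvalue_on (face_algebra n) T c}"
      unfolding T using signed_knapsack_imp_eigenvalue by blast
  qed
  then show ?thesis
    unfolding T using diagonalizable_signed_op alg_multiplicity_signed_op by blast
qed

end
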